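(* Let $n\ge p$ be positive integers, let $\mathbb{E}$ be a finite-dimensional Euclidean space, let $\mathcal{A}:\mathbb{R}^{n\times p}\to\mathbb{E}$ be linear and $b\in\mathbb{E}$. Let $\bar X\in\mathbb{R}^{n\times p}$ be a solution of $$\min_{X\in\mathbb{R}^{n\times p}}\|X\|_*\quad\text{s.t.}\quad\mathcal{A}(X)=b,$$ let $r:=\operatorname{rank}\bar X$, let $\bar X=\bar U\operatorname{diag}(\sigma(\bar X))\bar V^T$ be a singular value decomposition with $\bar U\in O(n)$, $\bar V\in O(p)$, and set $$W(\bar X):=\left\{\bar U M\begin{pmatrix}I_r&0\\0&R\end{pmatrix}\bar V^T\ :\ M\in\mathbb{S}^n_+-\mathcal{S}^r_{++},\ \operatorname{tr}(M)=0,\ R\in\mathcal{V}_{n-r,p-r},\ M\begin{pmatrix}I_r&0\\0&RR^T\end{pmatrix}=M\right\}.$$ Then the following are equivalent: (i) $\bar X$ is the unique solution of the problem $\min_{X\in\mathbb{R}^{n\times p}}\|X\|_*$ s.t. $\mathcal{A}(X)=b$. (ii) $\ker\mathcal{A}\cap W(\bar X)=\{0\}$.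
   Context: $\|\cdot\|_*$ is the nuclear norm (sum of singular values). $\sigma(\bar X)\in\mathbb{R}^p$ is the vector of singular values in nonincreasing order and $\operatorname{diag}(\sigma(\bar X))$ is the $n\times p$ rectangular diagonal matrix with these diagonal entries. $O(k)$ is the set of orthogonal $k\times k$ matrices; $\mathbb{S}^n_+$ the positive semidefinite symmetric $n\times n$ matrices; $\mathbb{S}^r_{++}$ the positive definite symmetric $r\times r$ matrices. $\mathcal{S}^r_{++}:=\left\{\begin{pmatrix}A&0\\0&0\end{pmatrix}\in\mathbb{S}^n_+: A\in\mathbb{S}^r_{++}\right\}$, and $\mathbb{S}^n_+-\mathcal{S}^r_{++}=\{P-S:P\in\mathbb{S}^n_+,S\in\mathcal{S}^r_{++}\}$. $\mathcal{V}_{m,q}=\{R\in\mathbb{R}^{m\times q}:R^TR=I_q\}$ is the Stiefel manifold. Blocks with zero rows or columns are void: if $r=p$ then $\mathcal{V}_{n-r,0}$ consists of the empty matrix and $RR^T=0\in\mathbb{R}^{(n-r)\times(n-r)}$; if $r=0$ then $\mathcal{S}^0_{++}=\{0\}$. *)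

theory Defs
  imports
    "HOL-Analysis.Inner_Product"
    "HOL-Computational_Algebra.Polynomial"
    "Jordan_Normal_Form.Char_Poly"
    "Jordan_Normal_Form.DL_Rank"
begin

text \<open>
  Matrices are those of Jordan\_Normal\_Form, whose dimensions are natural numbers and may
  be zero, so that the void blocks occurring for \<open>r = 0\<close> and \<open>r = p\<close> need no special treatment.
\<close>

text \<open>
  The singular values are the square roots of the eigenvalues of \<open>X\<^sup>T X\<close>, with multiplicity, in
  nonincreasing order. The list has one entry per column of \<open>X\<close>, which is the usual number of
  singular values when \<open>X\<close> has at least as many rows as columns.
\<close>

definition singular_values :: "real mat \<Rightarrow> real list" where
  "singular_values X =
     rev (sorted_list_of_multiset (image_mset sqrt (proots (char_poly (transpose_mat X * X)))))"

definition nuclear_norm :: "real mat \<Rightarrow> real" where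
  "nuclear_norm X = sum_list (singular_values X)"

definition rect_diag :: "nat \<Rightarrow> nat \<Rightarrow> real list \<Rightarrow> real mat" where
  "rect_diag n p s = mat n p (\<lambda>(i, j). if i = j then s ! i else 0)"

definition orthogonal_group :: "nat \<Rightarrow> real mat set" where
  "orthogonal_group k =
     {U \<in> carrier_mat k k. transpose_mat U * U = 1\<^sub>m k \<and> U * transpose_mat U = 1\<^sub>m k}"

definition stiefel :: "nat \<Rightarrow> nat \<Rightarrow> real mat set" where
  "stiefel m q = {R \<in> carrier_mat m q. transpose_mat R * R = 1\<^sub>m q}"

definition psd_mats :: "nat \<Rightarrow> real mat set" where
  "psd_mats k = {P \<in> carrier_mat k k. transpose_mat P = P \<and>
     (\<forall>x \<in> carrier_vec k. scalar_prod x (P *\<^sub>v x) \<ge> 0)}"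

definition pd_mats :: "nat \<Rightarrow> real mat set" where
  "pd_mats k = {P \<in> carrier_mat k k. transpose_mat P = P \<and>
     (\<forall>x \<in> carrier_vec k. x \<noteq> 0\<^sub>v k \<longrightarrow> scalar_prod x (P *\<^sub>v x) > 0)}"

definition pd_face :: "nat \<Rightarrow> nat \<Rightarrow> real mat set" where
  "pd_face n r = {S \<in> psd_mats n. \<exists>A \<in> pd_mats r.
     S = four_block_mat A (0\<^sub>m r (n - r)) (0\<^sub>m (n - r) r) (0\<^sub>m (n - r) (n - r))}"

definition psd_minus_pd_face :: "nat \<Rightarrow> nat \<Rightarrow> real mat set" where
  "psd_minus_pd_face n r = {P - S | P S. P \<in> psd_mats n \<and> S \<in> pd_face n r}"

definition mat_trace :: "real mat \<Rightarrow> real" where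
  "mat_trace M = (\<Sum>i < dim_row M. M $$ (i, i))"

definition linear_on_mats :: "nat \<Rightarrow> nat \<Rightarrow> (real mat \<Rightarrow> 'e::real_vector) \<Rightarrow> bool" where
  "linear_on_mats n p \<A> \<longleftrightarrow>
     (\<forall>X \<in> carrier_mat n p. \<forall>Y \<in> carrier_mat n p. \<A> (X + Y) = \<A> X + \<A> Y) \<and>
     (\<forall>c. \<forall>X \<in> carrier_mat n p. \<A> (c \<cdot>\<^sub>m X) = c *\<^sub>R \<A> X)"

definition kernel_on_mats :: "nat \<Rightarrow> nat \<Rightarrow> (real mat \<Rightarrow> 'e::real_vector) \<Rightarrow> real mat set" where
  "kernel_on_mats n p \<A> = {X \<in> carrier_mat n p. \<A> X = 0}"

definition nuclear_norm_solutions ::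
    "nat \<Rightarrow> nat \<Rightarrow> (real mat \<Rightarrow> 'e::real_vector) \<Rightarrow> 'e \<Rightarrow> real mat set" where
  "nuclear_norm_solutions n p \<A> b = {X \<in> carrier_mat n p. \<A> X = b \<and>
     (\<forall>Y \<in> carrier_mat n p. \<A> Y = b \<longrightarrow> nuclear_norm X \<le> nuclear_norm Y)}"

definition W_set :: "nat \<Rightarrow> nat \<Rightarrow> nat \<Rightarrow> real mat \<Rightarrow> real mat \<Rightarrow> real mat set" where
  "W_set n p r U V =
     {U * M * four_block_mat (1\<^sub>m r) (0\<^sub>m r (p - r)) (0\<^sub>m (n - r) r) R * transpose_mat V | M R.
        M \<in> psd_minus_pd_face n r \<and> mat_trace M = 0 \<and> R \<in> stiefel (n - r) (p - r) \<and>
        M * four_block_mat (1\<^sub>m r) (0\<^sub>m r (n - r)) (0\<^sub>m (n - r) r) (R * transpose_mat R) = M}"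

end

theory Submission
  imports Defs "HOL-Computational_Algebra.Fundamental_Theorem_Algebra"
begin

text \<open>
  The nuclear norm is dual to the Stiefel manifold: \<open>tr (G\<^sup>T X) \<le> \<parallel>X\<parallel>\<^sub>*\<close> for \<open>G\<^sup>T G = I\<close>, every
  \<open>X\<close> attains equality for some \<open>G\<close>, and equality forces \<open>X G\<^sup>T\<close> to be positive semidefinite.
  Conversely \<open>\<parallel>P Q\<parallel>\<^sub>* = tr P\<close> whenever \<open>P\<close> is positive semidefinite, \<open>Q\<^sup>T Q = I\<close> and \<open>P Q Q\<^sup>T = P\<close>.

  If \<open>Y\<close> is another solution, choose \<open>G\<close> attaining equality for the midpoint of \<open>X\<close> and \<open>Y\<close>; by
  minimality it attains equality for both. Equality for \<open>X\<close> says that \<open>U\<^sup>T G V\<close> is block diagonal with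
  blocks \<open>I\<^sub>r\<close> and some \<open>R\<close>, and equality for \<open>Y\<close> makes \<open>P = U\<^sup>T Y G\<^sup>T U\<close> positive semidefinite with
  trace \<open>\<parallel>X\<parallel>\<^sub>*\<close>, so that \<open>M = P - diag(\<sigma>\<^sub>1, \<dots>, \<sigma>\<^sub>r, 0, \<dots>, 0)\<close> exhibits \<open>Y - X\<close> as an element of \<open>W\<close>.
  If \<open>H \<in> W\<close> comes from \<open>M = P - S\<close>, then for small \<open>t > 0\<close> the matrix
  \<open>diag(\<sigma>\<^sub>1, \<dots>, \<sigma>\<^sub>r, 0, \<dots>, 0) + t M\<close> is still positive semidefinite, because \<open>t S\<close> is absorbed by the
  diagonal part, whence \<open>\<parallel>X + t H\<parallel>\<^sub>* = \<parallel>X\<parallel>\<^sub>*\<close>.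
\<close>

section \<open>Orthonormal families and Stiefel matrices\<close>

text \<open>Side conditions on dimensions, rather than on carriers with free inner dimensions, can
  be decided by rewriting, so this version serves as a simplification rule for normalising long
  products.\<close>

lemma mult_mat_assoc:
  fixes A B C :: "'a::semiring_0 mat"
  assumes "dim_col A = dim_row B" "dim_col B = dim_row C"
  shows "A * B * C = A * (B * C)"
  using assms by (intro assoc_mult_mat) auto

lemma mult_mat_cancel_left:
  fixes A B C :: "'a::semiring_1 mat"
  assumes "A * B = 1\<^sub>m k" "dim_col A = dim_row B" "dim_col B = dim_row C" "dim_row C = k"
  shows "A * (B * C) = C"
  using assms by (simp flip: mult_mat_assoc)

lemma transpose_mult_dim:
  fixes A B :: "'a::comm_semiring_0 mat"
  assumes "dim_col A = dim_row B"
  shows "(A * B)\<^sup>T = B\<^sup>T * A\<^sup>T"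
  using assms by (intro transpose_mult) auto

section \<open>Trace and scalar products\<close>

lemma mat_trace_mult_commute:
  assumes "A \<in> carrier_mat n m" "B \<in> carrier_mat m n"
  shows "mat_trace (A * B) = mat_trace (B * A)"
proof -
  have "mat_trace (A * B) = (\<Sum>i<n. \<Sum>j<m. A $$ (i, j) * B $$ (j, i))"
    using assms by (auto simp: mat_trace_def scalar_prod_def atLeast0LessThan intro!: sum.cong)
  also have "\<dots> = (\<Sum>j<m. \<Sum>i<n. B $$ (j, i) * A $$ (i, j))"
    by (subst sum.swap) (simp add: mult.commute)
  also have "\<dots> = mat_trace (B * A)"
    using assms by (auto simp: mat_trace_def scalar_prod_def atLeast0LessThan intro!: sum.cong)
  finally show ?thesis .
qed

lemma mat_trace_add:
  assumes "A \<in> carrier_mat n n" "B \<in> carrier_mat n n"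
  shows "mat_trace (A + B) = mat_trace A + mat_trace B"
  using assms by (auto simp: mat_trace_def sum.distrib)

lemma mat_trace_minus:
  assumes "A \<in> carrier_mat n n" "B \<in> carrier_mat n n"
  shows "mat_trace (A - B) = mat_trace A - mat_trace B"
  using assms by (auto simp: mat_trace_def sum_subtractf)

lemma mat_trace_smult: "A \<in> carrier_mat n n \<Longrightarrow> mat_trace (c \<cdot>\<^sub>m A) = c * mat_trace A"
  by (auto simp: mat_trace_def sum_distrib_left)

lemma scalar_prod_self_nonneg: "(0::real) \<le> v \<bullet> v"
  by (simp add: scalar_prod_def sum_nonneg)

lemma scalar_prod_self_eq_0_iff:
  assumes "v \<in> carrier_vec n"
  shows "v \<bullet> v = (0::real) \<longleftrightarrow> v = 0\<^sub>v n"
  using assms by (auto simp: scalar_prod_def sum_nonneg_eq_0_iff intro!: eq_vecI)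

lemma scalar_prod_mult_mat_vec:
  fixes A :: "real mat"
  assumes "A \<in> carrier_mat n m" "x \<in> carrier_vec n" "y \<in> carrier_vec m"
  shows "x \<bullet> (A *\<^sub>v y) = (A\<^sup>T *\<^sub>v x) \<bullet> y"
  using transpose_vec_mult_scalar[OF assms(1,3,2)] by simp

lemma normalized_vec:
  fixes v :: "real vec"
  assumes "v \<in> carrier_vec n" "v \<noteq> 0\<^sub>v n"
  shows "((1 / sqrt (v \<bullet> v)) \<cdot>\<^sub>v v) \<bullet> ((1 / sqrt (v \<bullet> v)) \<cdot>\<^sub>v v) = 1"
proof -
  have "0 < v \<bullet> v"
    using scalar_prod_self_eq_0_iff[OF assms(1)] scalar_prod_self_nonneg[of v] assms(2) by simp
  then show ?thesis
    using assms(1) by (simp add: real_div_sqrt field_simps)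
qed

text \<open>Fewer than \<open>n\<close> vectors are the rows of a singular \<open>n\<close> by
  \<open>n\<close> matrix once zero rows are added; a normalised kernel vector is orthogonal to all
  of them.\<close>

lemma ex_unit_vec_orthogonal:
  fixes S :: "real vec set"
  assumes "finite S" "S \<subseteq> carrier_vec n" "card S < n"
  shows "\<exists>v \<in> carrier_vec n. v \<bullet> v = 1 \<and> (\<forall>w\<in>S. w \<bullet> v = 0)"
proof -
  obtain xs where xs: "set xs = S" "distinct xs"
    using finite_distinct_list[OF assms(1)] by blast
  have len: "length xs < n"
    using xs assms(3) distinct_card[OF xs(2)] by simp
  define A where "A = mat_of_rows n (xs @ replicate (n - length xs) (0\<^sub>v n))"
  have A: "A \<in> carrier_mat n n"
    using len by (simp add: A_def carrier_matI)
  have row: "row A i = (if i < length xs then xs ! i else 0\<^sub>v n)" if "i < n" for i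
  proof -
    have "(xs @ replicate (n - length xs) (0\<^sub>v n)) ! i \<in> carrier_vec n"
      using that assms(2) xs(1) nth_mem[of i xs] by (cases "i < length xs") (auto simp: nth_append)
    then show ?thesis
      using that len unfolding A_def by (subst mat_of_rows_row) (auto simp: nth_append)
  qed
  \<comment> \<open>Since \<open>length xs < n\<close>, the last row of \<open>A\<close> is a
    padding row, so the transpose has a kernel vector and the determinant vanishes.\<close>
  have "A\<^sup>T *\<^sub>v unit_vec n (n - 1) = 0\<^sub>v n"
  proof (rule eq_vecI)
    fix i assume i: "i < dim_vec (0\<^sub>v n)"
    have "A $$ (n - 1, i) = row A (n - 1) $ i"
      using i A by simp
    also have "\<dots> = 0"
      using i len by (subst row) auto
    finally show "(A\<^sup>T *\<^sub>v unit_vec n (n - 1)) $ i = 0\<^sub>v n $ i"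
      using i A len by (auto simp: scalar_prod_right_unit)
  qed (use A in auto)
  moreover have "unit_vec n (n - 1) \<noteq> (0\<^sub>v n :: real vec)"
    using len unit_vec_nonzero[of "n - 1" n] by auto
  moreover have "A\<^sup>T \<in> carrier_mat n n"
    using A by simp
  ultimately have "det A\<^sup>T = 0"
    by (subst det_0_iff_vec_prod_zero) (auto intro!: exI[of _ "unit_vec n (n - 1)"])
  then obtain v where v: "v \<in> carrier_vec n" "v \<noteq> 0\<^sub>v n" "A *\<^sub>v v = 0\<^sub>v n"
    using det_transpose[OF A] det_0_iff_vec_prod_zero[OF A] by auto
  have "w \<bullet> v = 0" if w: "w \<in> S" for w
  proof -
    obtain i where i: "i < length xs" "w = xs ! i"
      using w xs(1) by (metis in_set_conv_nth)
    then have "w \<bullet> v = (A *\<^sub>v v) $ i"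
      using len A row[of i] by simp
    then show ?thesis
      using v(3) i len by simp
  qed
  then have "w \<bullet> ((1 / sqrt (v \<bullet> v)) \<cdot>\<^sub>v v) = 0" if "w \<in> S" for w
    using that assms(2) v(1) by (subst scalar_prod_smult_distrib[of _ n]) auto
  then show ?thesis
    using v(1) normalized_vec[OF v(1,2)]
    by (intro bexI[of _ "(1 / sqrt (v \<bullet> v)) \<cdot>\<^sub>v v"] conjI ballI) auto
qed

text \<open>Vectors are indexed by an arbitrary set, so that a family can first be prescribed at
  scattered indices, such as those of the nonzero singular values, and completed afterwards.\<close>

definition orthonormal_family :: "nat \<Rightarrow> 'i set \<Rightarrow> ('i \<Rightarrow> real vec) \<Rightarrow> bool" where
  "orthonormal_family n I u \<longleftrightarrow>
     (\<forall>i\<in>I. u i \<in> carrier_vec n) \<and> (\<forall>i\<in>I. \<forall>j\<in>I. u i \<bullet> u j = (if i = j then 1 else 0))"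

lemma orthonormal_family_insert:
  assumes "orthonormal_family n I u" "k \<notin> I" "v \<in> carrier_vec n" "v \<bullet> v = 1"
    and "\<And>i. i \<in> I \<Longrightarrow> u i \<bullet> v = 0"
  shows "orthonormal_family n (insert k I) (u(k := v))"
proof -
  have u: "u i \<in> carrier_vec n" if "i \<in> I" for i
    using assms(1) that by (simp add: orthonormal_family_def)
  have "(u(k := v)) i \<bullet> (u(k := v)) j = (if i = j then 1 else 0)"
    if ij: "i \<in> insert k I" "j \<in> insert k I" for i j
  proof -
    consider "i = k" "j = k" | "i = k" "j \<in> I" "j \<noteq> k" | "j = k" "i \<in> I" "i \<noteq> k" | "i \<in> I" "j \<in> I" "i \<noteq> k" "j \<noteq> k"
      using ij assms(2) by blast
    then show ?thesis
    proof cases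
      case 2
      then show ?thesis
        using assms(5)[of j] comm_scalar_prod[OF assms(3) u[of j]] by simp
    qed (use assms in \<open>auto simp: orthonormal_family_def\<close>)
  qed
  then show ?thesis
    using u assms(3) by (simp add: orthonormal_family_def)
qed

text \<open>Missing indices are filled one at a time: before each insertion fewer than
  \<open>n\<close> vectors are present, so a unit vector orthogonal to all of them exists.\<close>

lemma orthonormal_family_extend:
  assumes "finite J" "I \<subseteq> J" "card J \<le> n" "orthonormal_family n I u"
  shows "\<exists>u'. orthonormal_family n J u' \<and> (\<forall>i\<in>I. u' i = u i)"
proof -
  have "finite K \<Longrightarrow> K \<subseteq> J - I \<Longrightarrow>
    \<exists>u'. orthonormal_family n (I \<union> K) u' \<and> (\<forall>i\<in>I. u' i = u i)" for K
  proof (induction K rule: finite_induct)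
    case empty
    then show ?case using assms(4) by auto
  next
    case (insert k K)
    then obtain u' where u': "orthonormal_family n (I \<union> K) u'" "\<forall>i\<in>I. u' i = u i"
      by auto
    have fin: "finite (I \<union> K)"
      using assms(1,2) insert.hyps finite_subset by blast
    have "k \<notin> I \<union> K" "insert k (I \<union> K) \<subseteq> J"
      using insert assms(2) by auto
    then have "card (I \<union> K) < n"
      using fin assms(1,3) card_mono[of J "insert k (I \<union> K)"] by simp
    then have "card (u' ` (I \<union> K)) < n"
      using card_image_le[OF fin, of u'] by linarith
    moreover have "u' ` (I \<union> K) \<subseteq> carrier_vec n"
      using u'(1) by (auto simp: orthonormal_family_def)
    ultimately obtain v where v: "v \<in> carrier_vec n" "v \<bullet> v = 1" "\<forall>w\<in>u' ` (I \<union> K). w \<bullet> v = 0"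
      using ex_unit_vec_orthogonal[of "u' ` (I \<union> K)" n] fin by auto
    have "orthonormal_family n (I \<union> insert k K) (u'(k := v))"
      using orthonormal_family_insert[OF u'(1) \<open>k \<notin> I \<union> K\<close> v(1,2)] v(3) by simp
    moreover have "\<forall>i\<in>I. (u'(k := v)) i = u i"
      using u'(2) \<open>k \<notin> I \<union> K\<close> by auto
    ultimately show ?case by blast
  qed
  from this[of "J - I"] show ?thesis
    using assms(1,2) by (simp add: Un_absorb1)
qed

lemma stiefel_iff_cols:
  assumes "Q \<in> carrier_mat n p"
  shows "Q \<in> stiefel n p \<longleftrightarrow> orthonormal_family n {..<p} (col Q)"
proof
  assume "Q \<in> stiefel n p"
  then have Q: "Q\<^sup>T * Q = 1\<^sub>m p" by (simp add: stiefel_def)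
  have "col Q i \<bullet> col Q j = (if i = j then 1 else 0)" if "i < p" "j < p" for i j
    using arg_cong[OF Q, of "\<lambda>M. M $$ (i, j)"] that assms by simp
  then show "orthonormal_family n {..<p} (col Q)"
    using assms by (simp add: orthonormal_family_def)
next
  assume "orthonormal_family n {..<p} (col Q)"
  then show "Q \<in> stiefel n p"
    using assms by (auto simp: orthonormal_family_def stiefel_def intro!: eq_matI)
qed

lemma mat_of_cols_mem_stiefel:
  assumes "orthonormal_family n {..<p} u"
  shows "mat_of_cols n (map u [0..<p]) \<in> stiefel n p"
    and "i < p \<Longrightarrow> col (mat_of_cols n (map u [0..<p])) i = u i"
proof -
  have u: "u i \<in> carrier_vec n" if "i < p" for i
    using assms that by (auto simp: orthonormal_family_def)
  then have cols: "col (mat_of_cols n (map u [0..<p])) i = u i" if "i < p" for i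
    using that by (subst col_mat_of_cols) auto
  then show "i < p \<Longrightarrow> col (mat_of_cols n (map u [0..<p])) i = u i" .
  have "mat_of_cols n (map u [0..<p]) \<in> carrier_mat n p"
    by (simp add: carrier_matI)
  then show "mat_of_cols n (map u [0..<p]) \<in> stiefel n p"
    using assms cols by (subst stiefel_iff_cols) (auto simp: orthonormal_family_def)
qed

text \<open>A left inverse of a square matrix is also a right inverse. Closure properties proved for
  \<open>stiefel\<close> thereby apply to orthogonal matrices.\<close>

lemma orthogonal_group_eq_stiefel: "orthogonal_group n = stiefel n n"
proof -
  have "U * U\<^sup>T = 1\<^sub>m n" if "U \<in> carrier_mat n n" "U\<^sup>T * U = 1\<^sub>m n" for U :: "real mat"
    using mat_mult_left_right_inverse[of "U\<^sup>T" n U] that by simp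
  then show ?thesis
    unfolding orthogonal_group_def stiefel_def by blast
qed

lemma stiefel_mult:
  assumes "P \<in> stiefel n m" "Q \<in> stiefel m p"
  shows "P * Q \<in> stiefel n p"
proof -
  have c: "P \<in> carrier_mat n m" "Q \<in> carrier_mat m p" "P\<^sup>T * P = 1\<^sub>m m" "Q\<^sup>T * Q = 1\<^sub>m p"
    using assms by (auto simp: stiefel_def)
  have "(P * Q)\<^sup>T * (P * Q) = Q\<^sup>T * (P\<^sup>T * (P * Q))"
    using c(1,2) by (simp add: transpose_mult_dim mult_mat_assoc)
  also have "P\<^sup>T * (P * Q) = Q"
    using c by (intro mult_mat_cancel_left) auto
  finally show ?thesis
    using c by (simp add: stiefel_def)
qed

lemma transpose_mem_orthogonal_group: "U \<in> orthogonal_group n \<Longrightarrow> U\<^sup>T \<in> orthogonal_group n"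
  by (auto simp: orthogonal_group_def)

lemma stiefel_nonempty:
  assumes "p \<le> n"
  shows "stiefel n p \<noteq> {}"
proof -
  obtain u where "orthonormal_family n {..<p} u"
    using orthonormal_family_extend[of "{..<p}" "{}" n] assms by (auto simp: orthonormal_family_def)
  then show ?thesis
    using mat_of_cols_mem_stiefel(1) by blast
qed

section \<open>The spectral theorem for real symmetric matrices\<close>

text \<open>The fundamental theorem of algebra yields a complex eigenvector \<open>x + i y\<close>.
  Symmetry makes its eigenvalue real, so \<open>x\<close> and \<open>y\<close> satisfy the
  eigenvector equation separately, and one of them is nonzero.\<close>

lemma symmetric_mat_unit_eigenvector:
  fixes A :: "real mat"
  assumes A: "A \<in> carrier_mat n n" and sym: "A\<^sup>T = A" and n: "0 < n"
  shows "\<exists>a. \<exists>w \<in> carrier_vec n. w \<bullet> w = 1 \<and> A *\<^sub>v w = a \<cdot>\<^sub>v w"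
proof -
  define cA where "cA = map_mat complex_of_real A"
  have cA: "cA \<in> carrier_mat n n"
    using A by (simp add: cA_def)
  have "\<not> constant (poly (char_poly cA))"
    using degree_monic_char_poly[OF cA] n by (simp add: constant_degree)
  then obtain z where "poly (char_poly cA) z = 0"
    using fundamental_theorem_of_algebra by blast
  then have "eigenvalue cA z"
    using eigenvalue_root_char_poly[OF cA] by simp
  then obtain v where v: "v \<in> carrier_vec n" "v \<noteq> 0\<^sub>v n" "cA *\<^sub>v v = z \<cdot>\<^sub>v v"
    using cA by (auto simp: eigenvalue_def eigenvector_def)
  define x y where "x = map_vec Re v" and "y = map_vec Im v"
  have xy: "x \<in> carrier_vec n" "y \<in> carrier_vec n"
    using v(1) by (auto simp: x_def y_def)
  have eig: "(\<Sum>j<n. complex_of_real (A $$ (i, j)) * v $ j) = z * v $ i" if "i < n" for i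
    using arg_cong[OF v(3), of "\<lambda>u. u $ i"] that v(1) A
    by (simp add: cA_def scalar_prod_def atLeast0LessThan)
  have Ax: "A *\<^sub>v x = Re z \<cdot>\<^sub>v x - Im z \<cdot>\<^sub>v y"
  proof (rule eq_vecI)
    fix i assume "i < dim_vec (Re z \<cdot>\<^sub>v x - Im z \<cdot>\<^sub>v y)"
    then have i: "i < n" using xy by simp
    show "(A *\<^sub>v x) $ i = (Re z \<cdot>\<^sub>v x - Im z \<cdot>\<^sub>v y) $ i"
      using arg_cong[OF eig[OF i], of Re] i v(1) A
      by (simp add: x_def y_def scalar_prod_def atLeast0LessThan)
  qed (use A xy in auto)
  have Ay: "A *\<^sub>v y = Im z \<cdot>\<^sub>v x + Re z \<cdot>\<^sub>v y"
  proof (rule eq_vecI)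
    fix i assume "i < dim_vec (Im z \<cdot>\<^sub>v x + Re z \<cdot>\<^sub>v y)"
    then have i: "i < n" using xy by simp
    show "(A *\<^sub>v y) $ i = (Im z \<cdot>\<^sub>v x + Re z \<cdot>\<^sub>v y) $ i"
      using arg_cong[OF eig[OF i], of Im] i v(1) A
      by (simp add: x_def y_def scalar_prod_def atLeast0LessThan)
  qed (use A xy in auto)
  have ne: "x \<noteq> 0\<^sub>v n \<or> y \<noteq> 0\<^sub>v n"
  proof (rule ccontr)
    assume "\<not> ?thesis"
    then have 0: "x = 0\<^sub>v n" "y = 0\<^sub>v n" by auto
    have "v $ i = 0" if "i < n" for i
      using arg_cong[OF 0(1), of "\<lambda>u. u $ i"] arg_cong[OF 0(2), of "\<lambda>u. u $ i"] that v(1)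
      by (simp add: x_def y_def complex_eq_iff)
    then show False
      using v(1,2) by (auto intro!: eq_vecI)
  qed
  have pos: "0 < x \<bullet> x + y \<bullet> y"
    using ne scalar_prod_self_eq_0_iff[OF xy(1)] scalar_prod_self_eq_0_iff[OF xy(2)]
      scalar_prod_self_nonneg[of x] scalar_prod_self_nonneg[of y] by linarith
  \<comment> \<open>Expanding both sides by \<open>Ax\<close> and \<open>Ay\<close>, the terms with
    \<open>Re z\<close> cancel and \<open>Im z\<close> times the positive number
    \<open>x \<bullet> x + y \<bullet> y\<close> remains.\<close>
  have "x \<bullet> (A *\<^sub>v y) = (A *\<^sub>v x) \<bullet> y"
    using scalar_prod_mult_mat_vec[OF A xy] sym by simp
  then have "Im z * (x \<bullet> x) + Re z * (x \<bullet> y) = Re z * (x \<bullet> y) - Im z * (y \<bullet> y)"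
    using xy unfolding Ax Ay
    by (simp add: scalar_prod_add_distrib[of _ n] minus_scalar_prod_distrib[of _ n])
  then have "Im z * (x \<bullet> x + y \<bullet> y) = 0"
    by (simp add: algebra_simps)
  then have "Im z = 0"
    using pos by simp
  then have "A *\<^sub>v x = Re z \<cdot>\<^sub>v x" "A *\<^sub>v y = Re z \<cdot>\<^sub>v y"
    using Ax Ay xy by (auto intro!: eq_vecI)
  with ne xy obtain w where w: "w \<in> carrier_vec n" "w \<noteq> 0\<^sub>v n" "A *\<^sub>v w = Re z \<cdot>\<^sub>v w"
    by blast
  define w' where "w' = (1 / sqrt (w \<bullet> w)) \<cdot>\<^sub>v w"
  have "w' \<in> carrier_vec n" "w' \<bullet> w' = 1"
    using w(1) normalized_vec[OF w(1,2)] by (auto simp: w'_def)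
  moreover have "A *\<^sub>v w' = Re z \<cdot>\<^sub>v w'"
    using w A by (simp add: w'_def mult_mat_vec smult_smult_assoc mult.commute)
  ultimately show ?thesis by blast
qed

section \<open>Block diagonal matrices and orthogonal diagonalisation\<close>

lemma dim_mat_diag [simp]: "dim_row (mat_diag n f) = n" "dim_col (mat_diag n f) = n"
  by (simp_all add: mat_diag_def)

lemma mult_four_block_diag:
  fixes A A' D D' :: "'a::comm_semiring_1 mat"
  assumes "A \<in> carrier_mat a b" "A' \<in> carrier_mat b c" "D \<in> carrier_mat n m" "D' \<in> carrier_mat m q"
  shows "four_block_mat A (0\<^sub>m a m) (0\<^sub>m n b) D * four_block_mat A' (0\<^sub>m b q) (0\<^sub>m m c) D' =
    four_block_mat (A * A') (0\<^sub>m a q) (0\<^sub>m n c) (D * D')"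
proof -
  have "A * A' \<in> carrier_mat a c" "D * D' \<in> carrier_mat n q"
    using assms by auto
  moreover have "0\<^sub>m a m * D' = 0\<^sub>m a q" "0\<^sub>m n b * A' = 0\<^sub>m n c"
    "A * 0\<^sub>m b q = 0\<^sub>m a q" "D * 0\<^sub>m m c = 0\<^sub>m n c"
    "0\<^sub>m a m * 0\<^sub>m m c = (0\<^sub>m a c :: 'a mat)" "0\<^sub>m n b * 0\<^sub>m b q = (0\<^sub>m n q :: 'a mat)"
    using assms by auto
  ultimately show ?thesis
    using assms by (subst mult_four_block_mat[of _ a b _ m _ n _ _ c _ q]) auto
qed

lemma transpose_four_block_diag:
  assumes "A \<in> carrier_mat a b" "D \<in> carrier_mat n m"
  shows "(four_block_mat A (0\<^sub>m a m) (0\<^sub>m n b) D)\<^sup>T = four_block_mat A\<^sup>T (0\<^sub>m b n) (0\<^sub>m m a) D\<^sup>T"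
  using assms by (subst transpose_four_block_mat[of _ a b _ m _ n]) auto

lemma orthogonal_group_four_block:
  assumes "V \<in> orthogonal_group n"
  shows "four_block_mat (1\<^sub>m k) (0\<^sub>m k n) (0\<^sub>m n k) V \<in> orthogonal_group (k + n)"
proof -
  have V: "V \<in> carrier_mat n n" "V\<^sup>T * V = 1\<^sub>m n"
    using assms by (auto simp: orthogonal_group_def)
  have "(four_block_mat (1\<^sub>m k) (0\<^sub>m k n) (0\<^sub>m n k) V)\<^sup>T * four_block_mat (1\<^sub>m k) (0\<^sub>m k n) (0\<^sub>m n k) V
      = 1\<^sub>m (k + n)"
    using V by (simp add: transpose_four_block_diag mult_four_block_diag[of _ k k _ k _ n n _ n])
  then show ?thesis
    using V(1) by (simp add: orthogonal_group_eq_stiefel stiefel_def)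
qed

text \<open>Induction on the dimension: in an orthonormal basis whose first vector is an
  eigenvector, the matrix splits into a 1 by 1 block and a smaller symmetric block.\<close>

lemma symmetric_mat_spectral:
  fixes A :: "real mat"
  assumes "A \<in> carrier_mat n n" "A\<^sup>T = A"
  shows "\<exists>V \<in> orthogonal_group n. \<exists>d. A = V * mat_diag n d * V\<^sup>T"
  using assms
proof (induction n arbitrary: A)
  case 0
  then show ?case
    by (intro bexI[of _ "1\<^sub>m 0"]) (auto simp: orthogonal_group_def intro!: eq_matI)
next
  case (Suc n)
  note A = Suc.prems
  obtain a w where w: "w \<in> carrier_vec (Suc n)" "w \<bullet> w = 1" "A *\<^sub>v w = a \<cdot>\<^sub>v w"
    using symmetric_mat_unit_eigenvector[OF A] by auto
  \<comment> \<open>Extending from the index set \<open>{0}\<close> makes the eigenvector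
    \<open>w\<close> the first column of \<open>W\<close>.\<close>
  obtain u where u: "orthonormal_family (Suc n) {..<Suc n} u" "u 0 = w"
    using orthonormal_family_extend[of "{..<Suc n}" "{0}" "Suc n" "\<lambda>_. w"] w
    by (auto simp: orthonormal_family_def)
  define W where "W = mat_of_cols (Suc n) (map u [0..<Suc n])"
  have W: "W \<in> carrier_mat (Suc n) (Suc n)" "W\<^sup>T * W = 1\<^sub>m (Suc n)" "W * W\<^sup>T = 1\<^sub>m (Suc n)"
    using mat_of_cols_mem_stiefel(1)[OF u(1)]
    unfolding W_def orthogonal_group_eq_stiefel[symmetric] by (auto simp: orthogonal_group_def)
  have col_W: "col W i = u i" if "i < Suc n" for i
    using mat_of_cols_mem_stiefel(2)[OF u(1) that] by (simp add: W_def)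
  define B where "B = W\<^sup>T * A * W"
  have B: "B \<in> carrier_mat (Suc n) (Suc n)"
    using A W by (simp add: B_def)
  have B_sym: "B\<^sup>T = B"
    using A W by (simp add: B_def transpose_mult_dim mult_mat_assoc)
  have B_entry: "B $$ (i, j) = u i \<bullet> (A *\<^sub>v u j)" if "i < Suc n" "j < Suc n" for i j
  proof -
    have "B $$ (i, j) = (W\<^sup>T * (A * W)) $$ (i, j)"
      using A W by (simp add: B_def mult_mat_assoc)
    also have "\<dots> = col W i \<bullet> col (A * W) j"
      using that A W by simp
    also have "col (A * W) j = A *\<^sub>v col W j"
      using that A W by (intro col_mult2) auto
    finally show ?thesis
      using that by (simp add: col_W)
  qed
  have u_carrier: "u i \<in> carrier_vec (Suc n)" if "i < Suc n" for i
    using u(1) that by (simp add: orthonormal_family_def)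
  have B_col: "B $$ (i, 0) = (if i = 0 then a else 0)" if "i < Suc n" for i
    using that u u_carrier[OF that] w by (auto simp: B_entry orthonormal_family_def scalar_prod_smult_distrib)
  \<comment> \<open>The first column vanishes below the diagonal by orthogonality to
    \<open>w\<close>; symmetry carries this over to the first row.\<close>
  have B_row: "B $$ (0, i) = (if i = 0 then a else 0)" if "i < Suc n" for i
    using B_col[OF that] that B arg_cong[OF B_sym, of "\<lambda>M. M $$ (i, 0)"] by simp
  define B' where "B' = mat n n (\<lambda>(i, j). B $$ (Suc i, Suc j))"
  have B': "B' \<in> carrier_mat n n"
    by (simp add: B'_def)
  have "B'\<^sup>T = B'"
  proof (rule eq_matI)
    fix i j assume "i < dim_row B'" "j < dim_col B'"
    then show "B'\<^sup>T $$ (i, j) = B' $$ (i, j)"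
      using arg_cong[OF B_sym, of "\<lambda>M. M $$ (Suc i, Suc j)"] B by (simp add: B'_def)
  qed (simp_all add: B'_def)
  then obtain V d where V: "V \<in> orthogonal_group n" "B' = V * mat_diag n d * V\<^sup>T"
    using Suc.IH[OF B'] by blast
  have Vc: "V \<in> carrier_mat n n"
    using V(1) by (simp add: orthogonal_group_def)
  define Z where "Z = four_block_mat (1\<^sub>m 1) (0\<^sub>m 1 n) (0\<^sub>m n 1) V"
  define e where "e = (\<lambda>i. case i of 0 \<Rightarrow> a | Suc j \<Rightarrow> d j)"
  have Z: "Z \<in> orthogonal_group (Suc n)"
    using orthogonal_group_four_block[OF V(1), of 1] by (simp add: Z_def)
  have Zc: "Z \<in> carrier_mat (Suc n) (Suc n)"
    using Z by (simp add: orthogonal_group_def)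
  have B_block: "B = four_block_mat (a \<cdot>\<^sub>m 1\<^sub>m 1) (0\<^sub>m 1 n) (0\<^sub>m n 1) B'"
  proof (rule eq_matI)
    fix i j assume "i < dim_row (four_block_mat (a \<cdot>\<^sub>m 1\<^sub>m 1) (0\<^sub>m 1 n) (0\<^sub>m n 1) B')"
      "j < dim_col (four_block_mat (a \<cdot>\<^sub>m 1\<^sub>m 1) (0\<^sub>m 1 n) (0\<^sub>m n 1) B')"
    then show "B $$ (i, j) = four_block_mat (a \<cdot>\<^sub>m 1\<^sub>m 1) (0\<^sub>m 1 n) (0\<^sub>m n 1) B' $$ (i, j)"
      using B' B_row[of j] B_col[of i] by (cases i; cases j) (auto simp: B'_def)
  qed (use B B' in auto)
  have diag_block: "mat_diag (Suc n) e = four_block_mat (a \<cdot>\<^sub>m 1\<^sub>m 1) (0\<^sub>m 1 n) (0\<^sub>m n 1) (mat_diag n d)"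
    by (rule eq_matI) (auto simp: mat_diag_def e_def split: nat.split)
  have "Z * mat_diag (Suc n) e = four_block_mat (a \<cdot>\<^sub>m 1\<^sub>m 1) (0\<^sub>m 1 n) (0\<^sub>m n 1) (V * mat_diag n d)"
    using Vc unfolding Z_def diag_block by (subst mult_four_block_diag[of _ 1 1 _ 1 _ n n _ n]) auto
  then have "Z * mat_diag (Suc n) e * Z\<^sup>T = B"
    using Vc unfolding Z_def B_block V(2)
    by (simp add: transpose_four_block_diag mult_four_block_diag[of _ 1 1 _ 1 _ n n _ n, simplified])
  moreover have "W * Z * mat_diag (Suc n) e * (W * Z)\<^sup>T = W * (Z * mat_diag (Suc n) e * Z\<^sup>T * W\<^sup>T)"
    using W(1) Zc by (simp add: transpose_mult_dim mult_mat_assoc)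
  ultimately have "W * Z * mat_diag (Suc n) e * (W * Z)\<^sup>T = W * (B * W\<^sup>T)"
    by simp
  also have "\<dots> = (W * W\<^sup>T) * (A * (W * W\<^sup>T))"
    using W(1) A(1) by (simp add: B_def mult_mat_assoc)
  also have "\<dots> = A"
    using W A(1) by simp
  finally have "A = W * Z * mat_diag (Suc n) e * (W * Z)\<^sup>T" ..
  moreover have "W * Z \<in> orthogonal_group (Suc n)"
    using stiefel_mult[of W "Suc n" "Suc n" Z "Suc n"] W(1,2) Z
    by (simp add: orthogonal_group_eq_stiefel stiefel_def)
  ultimately show ?case by blast
qed

section \<open>Singular values and duality for the nuclear norm\<close>

lemma proots_prod_list_linear: "proots (\<Prod>a\<leftarrow>xs. [:- a, 1:]) = mset (xs :: 'a::idom list)"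
proof (induction xs)
  case (Cons a xs)
  have "(\<Prod>a\<leftarrow>xs. [:- a, 1:]) \<noteq> 0"
    by (auto simp: prod_list_zero_iff)
  then show ?case
    using Cons proots_mult[of "[:- a, 1:]" "\<Prod>a\<leftarrow>xs. [:- a, 1:]"] by (simp del: mult_pCons_left)
qed simp

text \<open>Conjugation by \<open>V\<close> is a similarity, so the characteristic polynomial is
  that of the diagonal matrix and splits into the linear factors of its entries.\<close>

lemma proots_char_poly_mat_diag:
  fixes d :: "nat \<Rightarrow> real"
  assumes "V \<in> orthogonal_group n"
  shows "proots (char_poly (V * mat_diag n d * V\<^sup>T)) = mset (map d [0..<n])"
proof -
  have "similar_mat (V * mat_diag n d * V\<^sup>T) (mat_diag n d)"
    using assms by (intro similar_matI[of _ _ V "V\<^sup>T" n]) (auto simp: orthogonal_group_def)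
  then have "char_poly (V * mat_diag n d * V\<^sup>T) = char_poly (mat_diag n d)"
    by (rule char_poly_similar)
  also have "\<dots> = (\<Prod>a\<leftarrow>diag_mat (mat_diag n d). [:- a, 1:])"
    by (rule char_poly_upper_triangular[of _ n]) (auto simp: mat_diag_def)
  also have "diag_mat (mat_diag n d) = map d [0..<n]"
    by (simp add: diag_mat_def mat_diag_def)
  finally show ?thesis
    by (simp only: proots_prod_list_linear)
qed

text \<open>A diagonalisation fixes no order of the eigenvalues, hence the comparison as multisets;
  this suffices for sums.\<close>

lemma mset_singular_values:
  assumes "V \<in> orthogonal_group p" "X\<^sup>T * X = V * mat_diag p d * V\<^sup>T"
  shows "mset (singular_values X) = mset (map (\<lambda>i. sqrt (d i)) [0..<p])"
  using assms by (simp add: singular_values_def proots_char_poly_mat_diag multiset.map_comp comp_def)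

lemma nuclear_norm_spectral:
  assumes "V \<in> orthogonal_group p" "X\<^sup>T * X = V * mat_diag p d * V\<^sup>T"
  shows "nuclear_norm X = (\<Sum>i<p. sqrt (d i))"
proof -
  have "nuclear_norm X = sum_mset (mset (singular_values X))"
    by (simp add: nuclear_norm_def sum_mset_sum_list)
  also have "\<dots> = sum_list (map (\<lambda>i. sqrt (d i)) [0..<p])"
    by (simp only: mset_singular_values[OF assms] sum_mset_sum_list)
  finally show ?thesis
    by (simp add: sum_list_distinct_conv_sum_set atLeast0LessThan)
qed

lemma orthogonal_conj_eq:
  assumes "V \<in> orthogonal_group n" "A \<in> carrier_mat n n" "A = V * D * V\<^sup>T" "D \<in> carrier_mat n n"
  shows "V\<^sup>T * A * V = D"
proof -
  have V: "V \<in> carrier_mat n n" "V\<^sup>T * V = 1\<^sub>m n"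
    using assms(1) by (auto simp: orthogonal_group_def)
  have "V\<^sup>T * A * V = (V\<^sup>T * V) * (D * (V\<^sup>T * V))"
    using V(1) assms(4) unfolding assms(3) by (simp add: mult_mat_assoc)
  then show ?thesis
    using V assms(4) by simp
qed

text \<open>The eigenvalues of \<open>X\<^sup>T * X\<close> are squared lengths of the columns of
  \<open>X * V\<close>, hence squares of nonnegative numbers.\<close>

lemma gram_spectral:
  assumes X: "X \<in> carrier_mat n p"
  shows "\<exists>V \<in> orthogonal_group p. \<exists>s. (\<forall>i. 0 \<le> s i) \<and>
    X\<^sup>T * X = V * mat_diag p (\<lambda>i. s i * s i) * V\<^sup>T"
proof -
  have "X\<^sup>T * X \<in> carrier_mat p p" "(X\<^sup>T * X)\<^sup>T = X\<^sup>T * X"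
    using X by (simp_all add: transpose_mult_dim)
  then obtain V d where V: "V \<in> orthogonal_group p" "X\<^sup>T * X = V * mat_diag p d * V\<^sup>T"
    using symmetric_mat_spectral by blast
  have Vc: "V \<in> carrier_mat p p"
    using V(1) by (simp add: orthogonal_group_def)
  have XV: "(X * V)\<^sup>T * (X * V) = mat_diag p d"
    using orthogonal_conj_eq[OF V(1) _ V(2)] X Vc by (simp add: transpose_mult_dim mult_mat_assoc)
  have nonneg: "0 \<le> d i" if "i < p" for i
  proof -
    have "d i = mat_diag p d $$ (i, i)"
      using that by (simp add: mat_diag_def)
    also have "\<dots> = col (X * V) i \<bullet> col (X * V) i"
      using that X Vc by (simp flip: XV)
    finally show ?thesis
      using scalar_prod_self_nonneg by simp
  qed
  \<comment> \<open>Nothing is known about \<open>d i\<close> for \<open>i \<ge> p\<close>; the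
    default 0 makes \<open>s\<close> nonnegative at every index.\<close>
  define s where "s = (\<lambda>i. if i < p then sqrt (d i) else 0)"
  have "mat_diag p (\<lambda>i. s i * s i) = mat_diag p d"
    using nonneg by (auto simp: mat_diag_def s_def)
  moreover have "\<forall>i. 0 \<le> s i"
    using nonneg by (simp add: s_def)
  ultimately show ?thesis
    using V by (intro bexI[of _ V] exI[of _ s]) auto
qed

lemma transpose_mat_diag [simp]: "(mat_diag n f)\<^sup>T = mat_diag n f"
  by (auto simp: mat_diag_def)

lemma gram_thin_svd:
  assumes "Q \<in> stiefel n p" "V \<in> orthogonal_group p" "X = Q * mat_diag p s * V\<^sup>T"
  shows "X\<^sup>T * X = V * mat_diag p (\<lambda>i. s i * s i) * V\<^sup>T"
proof -
  have Q: "Q \<in> carrier_mat n p" "Q\<^sup>T * Q = 1\<^sub>m p" and V: "V \<in> carrier_mat p p"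
    using assms(1,2) by (auto simp: stiefel_def orthogonal_group_def)
  have "X\<^sup>T * X = V * (mat_diag p s * ((Q\<^sup>T * Q) * (mat_diag p s * V\<^sup>T)))"
    using Q(1) V unfolding assms(3) by (simp add: transpose_mult_dim mult_mat_assoc)
  also have "\<dots> = V * (mat_diag p s * mat_diag p s) * V\<^sup>T"
    using Q V unfolding Q(2) by (subst left_mult_one_mat[of _ p p]) (auto simp: mult_mat_assoc simp del: mat_diag_diag)
  finally show ?thesis by simp
qed

text \<open>The columns of \<open>X * V\<close> are orthogonal with lengths \<open>s i\<close>.
  Normalising the nonzero ones and completing them to \<open>p\<close> orthonormal vectors, for
  which \<open>p \<le> n\<close> leaves room, gives \<open>Q\<close>.\<close>

lemma ex_thin_svd:
  assumes X: "X \<in> carrier_mat n p" and "p \<le> n"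
  shows "\<exists>Q \<in> stiefel n p. \<exists>V \<in> orthogonal_group p. \<exists>s. (\<forall>i. 0 \<le> s i) \<and> X = Q * mat_diag p s * V\<^sup>T"
proof -
  obtain V s where V: "V \<in> orthogonal_group p" and s: "\<forall>i. 0 \<le> s i"
    and gram: "X\<^sup>T * X = V * mat_diag p (\<lambda>i. s i * s i) * V\<^sup>T"
    using gram_spectral[OF X] by blast
  have Vc: "V \<in> carrier_mat p p" "V * V\<^sup>T = 1\<^sub>m p"
    using V by (auto simp: orthogonal_group_def)
  define Y where "Y = X * V"
  have Y: "Y \<in> carrier_mat n p"
    using X Vc by (simp add: Y_def)
  have YY: "Y\<^sup>T * Y = mat_diag p (\<lambda>i. s i * s i)"
    using orthogonal_conj_eq[OF V _ gram] X Vc by (simp add: Y_def transpose_mult_dim mult_mat_assoc)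
  have Y_col: "col Y i \<bullet> col Y j = (if i = j then s i * s i else 0)" if "i < p" "j < p" for i j
    using arg_cong[OF YY, of "\<lambda>M. M $$ (i, j)"] that Y by (simp add: mat_diag_def)
  define I where "I = {i. i < p \<and> s i \<noteq> 0}"
  have "orthonormal_family n I (\<lambda>i. (1 / s i) \<cdot>\<^sub>v col Y i)"
    unfolding orthonormal_family_def
  proof (intro conjI ballI)
    fix i j assume "i \<in> I" "j \<in> I"
    then show "((1 / s i) \<cdot>\<^sub>v col Y i) \<bullet> ((1 / s j) \<cdot>\<^sub>v col Y j) = (if i = j then 1 else 0)"
      using Y Y_col[of i j] by (auto simp: I_def)
  qed (use Y in auto)
  then obtain u where u: "orthonormal_family n {..<p} u" "\<forall>i\<in>I. u i = (1 / s i) \<cdot>\<^sub>v col Y i"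
    using orthonormal_family_extend[of "{..<p}" I n] assms(2) by (auto simp: I_def)
  define Q where "Q = mat_of_cols n (map u [0..<p])"
  have Q_col: "col Q i = u i" if "i < p" for i
    using mat_of_cols_mem_stiefel(2)[OF u(1) that] by (simp add: Q_def)
  have Qc: "Q \<in> carrier_mat n p"
    by (simp add: Q_def carrier_matI)
  have "Q * mat_diag p s = Y"
  proof (rule eq_matI)
    fix i j assume ij: "i < dim_row Y" "j < dim_col Y"
    then have ij': "i < n" "j < p"
      using Y by auto
    \<comment> \<open>Where \<open>s j = 0\<close> the column of \<open>Y\<close> is zero, so the
      choice of \<open>u j\<close> made by the completion does not matter.\<close>
    have "Y $$ (i, j) = u j $ i * s j"
    proof (cases "s j = 0")
      case True
      then have "col Y j = 0\<^sub>v n"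
        using Y_col[of j j] ij' Y scalar_prod_self_eq_0_iff[of "col Y j" n] by simp
      moreover have "Y $$ (i, j) = col Y j $ i"
        using ij by simp
      ultimately show ?thesis
        using True ij' by simp
    next
      case False
      then have "u j = (1 / s j) \<cdot>\<^sub>v col Y j"
        using u(2) ij' by (simp add: I_def)
      then show ?thesis
        using False ij' Y by simp
    qed
    also have "u j $ i = Q $$ (i, j)"
      using Q_col[OF ij'(2)] ij' Qc by (metis carrier_matD index_col)
    finally show "(Q * mat_diag p s) $$ (i, j) = Y $$ (i, j)"
      using ij' Qc by (subst mat_diag_mult_right[of _ n]) auto
  qed (use Y Qc in auto)
  moreover have "Y * V\<^sup>T = X"
    using X Vc by (simp add: Y_def mult_mat_assoc)
  moreover have "Q \<in> stiefel n p"
    using mat_of_cols_mem_stiefel(1)[OF u(1)] by (simp add: Q_def)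
  ultimately show ?thesis
    using V s by (intro bexI[of _ Q] bexI[of _ V] exI[of _ s]) auto
qed

lemma nuclear_norm_thin_svd:
  assumes "Q \<in> stiefel n p" "V \<in> orthogonal_group p" "X = Q * mat_diag p s * V\<^sup>T" "\<forall>i. 0 \<le> s i"
  shows "nuclear_norm X = (\<Sum>i<p. s i)"
  using nuclear_norm_spectral[OF assms(2) gram_thin_svd[OF assms(1-3)]] assms(4) by simp

section \<open>Positive semidefinite matrices and the nuclear norm of a polar form\<close>

lemma psd_mats_congruence:
  assumes "P \<in> psd_mats n" "C \<in> carrier_mat n m"
  shows "C\<^sup>T * P * C \<in> psd_mats m"
proof -
  have P: "P \<in> carrier_mat n n" "P\<^sup>T = P" "\<And>x. x \<in> carrier_vec n \<Longrightarrow> 0 \<le> x \<bullet> (P *\<^sub>v x)"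
    using assms(1) by (auto simp: psd_mats_def)
  have "0 \<le> x \<bullet> (C\<^sup>T * P * C *\<^sub>v x)" if x: "x \<in> carrier_vec m" for x
  proof -
    have "C\<^sup>T * P * C *\<^sub>v x = C\<^sup>T *\<^sub>v (P *\<^sub>v (C *\<^sub>v x))"
      using P(1) assms(2) x by (simp add: mult_mat_assoc assoc_mult_mat_vec[of _ m n _ m] assoc_mult_mat_vec[of _ n n _ m]
          assoc_mult_mat_vec[of _ n m])
    then have "x \<bullet> (C\<^sup>T * P * C *\<^sub>v x) = (C *\<^sub>v x) \<bullet> (P *\<^sub>v (C *\<^sub>v x))"
      using P(1) assms(2) x by (simp add: scalar_prod_mult_mat_vec[of _ m n])
    then show ?thesis
      using P(3)[of "C *\<^sub>v x"] assms(2) x by simp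
  qed
  moreover have "(C\<^sup>T * P * C)\<^sup>T = C\<^sup>T * P * C"
    using P assms(2) by (simp add: transpose_mult_dim mult_mat_assoc)
  ultimately show ?thesis
    using P(1) assms(2) by (simp add: psd_mats_def)
qed

lemma scalar_prod_mat_diag:
  fixes d :: "nat \<Rightarrow> real"
  assumes "x \<in> carrier_vec n"
  shows "x \<bullet> (mat_diag n d *\<^sub>v x) = (\<Sum>i<n. d i * (x $ i)\<^sup>2)"
proof -
  have "(mat_diag n d *\<^sub>v x) $ i = d i * x $ i" if "i < n" for i
  proof -
    have "(mat_diag n d *\<^sub>v x) $ i = (\<Sum>j<n. (if i = j then d j else 0) * x $ j)"
      using that assms by (simp add: mat_diag_def scalar_prod_def atLeast0LessThan)
    also have "\<dots> = (\<Sum>j<n. if i = j then d j * x $ j else 0)"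
      by (intro sum.cong) auto
    finally show ?thesis
      using that by simp
  qed
  then show ?thesis
    by (auto simp: scalar_prod_def atLeast0LessThan power2_eq_square mult_ac intro!: sum.cong)
qed

lemma mat_diag_mem_psd_mats:
  assumes "\<And>i. i < n \<Longrightarrow> 0 \<le> d i"
  shows "mat_diag n d \<in> psd_mats n"
  using assms by (auto simp: psd_mats_def scalar_prod_mat_diag intro!: sum_nonneg)

text \<open>\<open>B\<close> is the positive semidefinite square root of the Gram matrix, so its
  eigenvalues are the singular values of \<open>X\<close>.\<close>

lemma nuclear_norm_eq_trace:
  assumes B: "B \<in> psd_mats p" and BB: "B * B = X\<^sup>T * X"
  shows "nuclear_norm X = mat_trace B"
proof -
  have Bc: "B \<in> carrier_mat p p" "B\<^sup>T = B"
    using B by (auto simp: psd_mats_def)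
  obtain V d where V: "V \<in> orthogonal_group p" and Bd: "B = V * mat_diag p d * V\<^sup>T"
    using symmetric_mat_spectral[OF Bc] by blast
  have Vc: "V \<in> carrier_mat p p" "V\<^sup>T * V = 1\<^sub>m p"
    using V by (auto simp: orthogonal_group_def)
  have D: "mat_diag p d \<in> psd_mats p"
    using psd_mats_congruence[OF B Vc(1)] orthogonal_conj_eq[OF V Bc(1) Bd] by simp
  have nonneg: "0 \<le> d i" if "i < p" for i
  proof -
    \<comment> \<open>Testing the quadratic form on a unit vector isolates one diagonal
      entry.\<close>
    have "0 \<le> unit_vec p i \<bullet> (mat_diag p d *\<^sub>v unit_vec p i)"
      using D by (simp add: psd_mats_def)
    also have "\<dots> = (\<Sum>j<p. if j = i then d j else 0)"
      using that unfolding scalar_prod_mat_diag[OF unit_vec_carrier] by (intro sum.cong) auto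
    finally show ?thesis
      using that by simp
  qed
  have "B * B = V * (mat_diag p d * ((V\<^sup>T * V) * (mat_diag p d * V\<^sup>T)))"
    using Vc(1) unfolding Bd by (simp add: mult_mat_assoc)
  also have "\<dots> = V * (mat_diag p d * mat_diag p d) * V\<^sup>T"
    using Vc(1) unfolding Vc(2) by (subst left_mult_one_mat[of _ p p]) (auto simp: mult_mat_assoc simp del: mat_diag_diag)
  finally have "X\<^sup>T * X = V * mat_diag p (\<lambda>i. d i * d i) * V\<^sup>T"
    using BB by simp
  then have "nuclear_norm X = (\<Sum>i<p. sqrt (d i * d i))"
    by (rule nuclear_norm_spectral[OF V])
  also have "\<dots> = (\<Sum>i<p. d i)"
    using nonneg by (intro sum.cong) auto
  also have "\<dots> = mat_trace (mat_diag p d)"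
    by (simp add: mat_trace_def mat_diag_def)
  also have "\<dots> = mat_trace ((mat_diag p d * V\<^sup>T) * V)"
    using Vc by (simp add: mult_mat_assoc)
  also have "\<dots> = mat_trace B"
    using Vc(1) unfolding Bd by (subst mat_trace_mult_commute[of _ p p]) (auto simp: mult_mat_assoc)
  finally show ?thesis .
qed

text \<open>By \<open>PQQ\<close>, the square of \<open>Q\<^sup>T * P * Q\<close> is the Gram matrix
  of \<open>P * Q\<close>. Its trace equals that of \<open>P * (Q * Q\<^sup>T)\<close>, which is
  \<open>P\<close>.\<close>

lemma nuclear_norm_polar:
  assumes P: "P \<in> psd_mats n" and Q: "Q \<in> stiefel n p" and PQQ: "P * (Q * Q\<^sup>T) = P"
  shows "nuclear_norm (P * Q) = mat_trace P"
proof -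
  have c: "P \<in> carrier_mat n n" "P\<^sup>T = P" "Q \<in> carrier_mat n p"
    using P Q by (auto simp: psd_mats_def stiefel_def)
  have "(Q\<^sup>T * P * Q) * (Q\<^sup>T * P * Q) = Q\<^sup>T * ((P * (Q * Q\<^sup>T)) * (P * Q))"
    using c by (simp add: mult_mat_assoc)
  also have "\<dots> = (P * Q)\<^sup>T * (P * Q)"
    using c unfolding PQQ by (simp add: transpose_mult_dim mult_mat_assoc)
  finally have "nuclear_norm (P * Q) = mat_trace (Q\<^sup>T * P * Q)"
    using psd_mats_congruence[OF P c(3)] by (intro nuclear_norm_eq_trace)
  also have "\<dots> = mat_trace (P * Q * Q\<^sup>T)"
    using c by (simp add: mult_mat_assoc mat_trace_mult_commute[of "Q\<^sup>T" p n])
  also have "\<dots> = mat_trace P"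
    using c PQQ by (simp add: mult_mat_assoc)
  finally show ?thesis .
qed

text \<open>This identity yields both the Cauchy-Schwarz bound for unit vectors and its equality
  case.\<close>

lemma unit_vec_dist:
  assumes "a \<in> carrier_vec n" "b \<in> carrier_vec n" "a \<bullet> a = 1" "b \<bullet> b = (1::real)"
  shows "(a - b) \<bullet> (a - b) = 2 * (1 - a \<bullet> b)"
  using assms comm_scalar_prod[OF assms(1,2)]
  by (simp add: minus_scalar_prod_distrib[of _ n] scalar_prod_minus_distrib[of _ n])

lemma unit_scalar_prod_le_1:
  assumes "a \<in> carrier_vec n" "b \<in> carrier_vec n" "a \<bullet> a = 1" "b \<bullet> b = (1::real)"
  shows "a \<bullet> b \<le> 1"
  using unit_vec_dist[OF assms] scalar_prod_self_nonneg[of "a - b"] by simp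

lemma unit_scalar_prod_eq_1:
  assumes "a \<in> carrier_vec n" "b \<in> carrier_vec n" "a \<bullet> a = 1" "b \<bullet> b = (1::real)" "a \<bullet> b = 1"
  shows "a = b"
proof -
  have "a - b = 0\<^sub>v n"
    using unit_vec_dist[OF assms(1-4)] assms(1,2,5) scalar_prod_self_eq_0_iff[of "a - b" n] by simp
  then have "a $ i = b $ i" if "i < n" for i
  proof -
    have "(a - b) $ i = 0"
      using \<open>a - b = 0\<^sub>v n\<close> that by simp
    then show ?thesis
      using that assms(1,2) by simp
  qed
  then show ?thesis
    using assms(1,2) by (intro eq_vecI) auto
qed

section \<open>Trace duality and its equality case\<close>

lemma trace_thin_svd:
  assumes "Q \<in> carrier_mat n p" "G \<in> carrier_mat n p" "V \<in> carrier_mat p p"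
  shows "mat_trace (G\<^sup>T * (Q * mat_diag p s * V\<^sup>T)) = (\<Sum>i<p. s i * (col (G * V) i \<bullet> col Q i))"
proof -
  have "mat_trace (G\<^sup>T * (Q * mat_diag p s * V\<^sup>T)) = mat_trace (((G * V)\<^sup>T * Q) * mat_diag p s)"
    using assms mat_trace_mult_commute[of "G\<^sup>T * (Q * mat_diag p s)" p p "V\<^sup>T"]
    by (simp add: mult_mat_assoc transpose_mult_dim)
  also have "(G * V)\<^sup>T * Q * mat_diag p s = mat p p (\<lambda>(i, j). ((G * V)\<^sup>T * Q) $$ (i, j) * s j)"
    using assms by (intro mat_diag_mult_right mult_carrier_mat[of _ p n]) auto
  also have "mat_trace \<dots> = (\<Sum>i<p. s i * (col (G * V) i \<bullet> col Q i))"
    using assms by (auto simp: mat_trace_def intro!: sum.cong)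
  finally show ?thesis .
qed

text \<open>The trace is a sum of inner products of unit columns with weights \<open>s i\<close>,
  each inner product being at most 1. Equality of the sums forces equality in every term, and a
  nonzero weight then makes the two columns coincide.\<close>

lemma trace_thin_svd_le_nuclear_norm:
  assumes Q: "Q \<in> stiefel n p" and V: "V \<in> orthogonal_group p" and Xs: "X = Q * mat_diag p s * V\<^sup>T"
    and s: "\<forall>i. 0 \<le> s i" and G: "G \<in> stiefel n p"
  shows "mat_trace (G\<^sup>T * X) \<le> nuclear_norm X" (is ?le)
    and "mat_trace (G\<^sup>T * X) = nuclear_norm X \<Longrightarrow> i < p \<Longrightarrow> s i \<noteq> 0 \<Longrightarrow> col (G * V) i = col Q i"
      (is "?eq \<Longrightarrow> _ \<Longrightarrow> _ \<Longrightarrow> ?col")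
proof -
  have c: "Q \<in> carrier_mat n p" "V \<in> carrier_mat p p" "G \<in> carrier_mat n p"
    using Q V G by (auto simp: orthogonal_group_def stiefel_def)
  have GV: "G * V \<in> stiefel n p"
    using stiefel_mult[OF G] V by (simp add: orthogonal_group_eq_stiefel)
  have unit: "col Q i \<in> carrier_vec n" "col Q i \<bullet> col Q i = 1"
    "col (G * V) i \<in> carrier_vec n" "col (G * V) i \<bullet> col (G * V) i = 1" if "i < p" for i
    using Q GV stiefel_iff_cols[of Q n p] stiefel_iff_cols[of "G * V" n p] c that
    by (auto simp: orthonormal_family_def)
  have tr: "mat_trace (G\<^sup>T * X) = (\<Sum>i<p. s i * (col (G * V) i \<bullet> col Q i))"
    using trace_thin_svd[OF c(1,3,2)] Xs by simp
  have nn: "nuclear_norm X = (\<Sum>i<p. s i)"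
    using nuclear_norm_thin_svd[OF Q V Xs s] .
  have le: "s i * (col (G * V) i \<bullet> col Q i) \<le> s i" if "i < p" for i
    using unit_scalar_prod_le_1[OF unit(3)[OF that] unit(1)[OF that] unit(4)[OF that] unit(2)[OF that]] s
    by (simp add: mult_left_le)
  show ?le
    unfolding tr nn using le by (intro sum_mono) simp
  show ?col if ?eq and i: "i < p" "s i \<noteq> 0"
  proof -
    have "s i * (col (G * V) i \<bullet> col Q i) = s i"
      using sum_mono_inv[of "\<lambda>i. s i * (col (G * V) i \<bullet> col Q i)" "{..<p}" s i] \<open>?eq\<close> le i(1)
      unfolding tr nn by simp
    then show ?thesis
      using unit_scalar_prod_eq_1[OF unit(3)[OF i(1)] unit(1)[OF i(1)] unit(4)[OF i(1)] unit(2)[OF i(1)]] i(2)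
      by simp
  qed
qed

lemma trace_le_nuclear_norm:
  assumes X: "X \<in> carrier_mat n p" and "p \<le> n" and G: "G \<in> stiefel n p"
  shows "mat_trace (G\<^sup>T * X) \<le> nuclear_norm X" (is ?le)
    and "mat_trace (G\<^sup>T * X) = nuclear_norm X \<Longrightarrow> X * G\<^sup>T \<in> psd_mats n" (is "?eq \<Longrightarrow> ?psd")
proof -
  obtain Q V s where Q: "Q \<in> stiefel n p" and V: "V \<in> orthogonal_group p" and s: "\<forall>i. 0 \<le> s i"
    and Xs: "X = Q * mat_diag p s * V\<^sup>T"
    using ex_thin_svd[OF X assms(2)] by blast
  have c: "Q \<in> carrier_mat n p" "V \<in> carrier_mat p p" "G \<in> carrier_mat n p"
    using Q V G by (auto simp: orthogonal_group_def stiefel_def)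
  show ?le
    using trace_thin_svd_le_nuclear_norm(1)[OF Q V Xs s G] .
  show ?psd if ?eq
  proof -
    \<comment> \<open>The columns of \<open>G * V\<close> and \<open>Q\<close> can differ only where
      \<open>s\<close> vanishes, and scaling by \<open>s\<close> erases these. Hence
      \<open>X * G\<^sup>T\<close> is a congruence of \<open>mat_diag p s\<close>.\<close>
    have "(G * V) * mat_diag p s = Q * mat_diag p s"
    proof (rule eq_matI)
      fix i j assume "i < dim_row (Q * mat_diag p s)" "j < dim_col (Q * mat_diag p s)"
      then have ij: "i < n" "j < p"
        using c by auto
      have "s j = 0 \<or> col (G * V) j = col Q j"
        using trace_thin_svd_le_nuclear_norm(2)[OF Q V Xs s G \<open>?eq\<close> ij(2)] by blast
      then have "col (G * V) j $ i * s j = col Q j $ i * s j"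
        by auto
      then have "(G * V) $$ (i, j) * s j = Q $$ (i, j) * s j"
        using ij c by (simp only: index_col carrier_matD dim_row_mat index_mult_mat(2,3))
      then show "((G * V) * mat_diag p s) $$ (i, j) = (Q * mat_diag p s) $$ (i, j)"
        using ij c by (simp add: mat_diag_mult_right[of _ n] del: index_mult_mat(1))
    qed (use c in auto)
    then have "X * G\<^sup>T = ((G * V)\<^sup>T)\<^sup>T * mat_diag p s * (G * V)\<^sup>T"
      using c unfolding Xs by (simp add: mult_mat_assoc transpose_mult_dim)
    also have "\<dots> \<in> psd_mats n"
      using s c by (intro psd_mats_congruence[of _ p] mat_diag_mem_psd_mats) auto
    finally show ?thesis .
  qed
qed

text \<open>With \<open>G = Q * V\<^sup>T\<close> the columns of \<open>G * V\<close> are those of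
  \<open>Q\<close>, so every inner product in the trace formula equals 1.\<close>

lemma ex_trace_eq_nuclear_norm:
  assumes X: "X \<in> carrier_mat n p" and "p \<le> n"
  shows "\<exists>G \<in> stiefel n p. mat_trace (G\<^sup>T * X) = nuclear_norm X"
proof -
  obtain Q V s where Q: "Q \<in> stiefel n p" and V: "V \<in> orthogonal_group p" and s: "\<forall>i. 0 \<le> s i"
    and Xs: "X = Q * mat_diag p s * V\<^sup>T"
    using ex_thin_svd[OF X assms(2)] by blast
  have c: "Q \<in> carrier_mat n p" "V \<in> carrier_mat p p" "V\<^sup>T * V = 1\<^sub>m p"
    using Q V by (auto simp: orthogonal_group_def stiefel_def)
  have QV: "Q * V\<^sup>T \<in> stiefel n p"
    using stiefel_mult[OF Q] transpose_mem_orthogonal_group[OF V] by (simp add: orthogonal_group_eq_stiefel)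
  have "Q * V\<^sup>T * V = Q"
    using c by (simp add: mult_mat_assoc)
  moreover have "col Q i \<bullet> col Q i = 1" if "i < p" for i
    using Q stiefel_iff_cols[OF c(1)] that by (simp add: orthonormal_family_def)
  ultimately have "mat_trace ((Q * V\<^sup>T)\<^sup>T * X) = nuclear_norm X"
    using trace_thin_svd[of Q n p "Q * V\<^sup>T" V s] c nuclear_norm_thin_svd[OF Q V Xs s] Xs by simp
  with QV show ?thesis by blast
qed

section \<open>Rank and rectangular diagonal matrices\<close>

text \<open>A diagonal given by a function, rather than a list, covers truncated identities and is
  stable under transposition and products of varying shapes.\<close>

definition rdiag :: "nat \<Rightarrow> nat \<Rightarrow> (nat \<Rightarrow> real) \<Rightarrow> real mat" where
  "rdiag n p f = mat n p (\<lambda>(i, j). if i = j then f i else 0)"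

lemma rdiag_carrier [simp]: "rdiag n p f \<in> carrier_mat n p"
  by (simp add: rdiag_def)

lemma dim_rdiag [simp]: "dim_row (rdiag n p f) = n" "dim_col (rdiag n p f) = p"
  by (simp_all add: rdiag_def)

lemma rect_diag_eq_rdiag: "rect_diag n p s = rdiag n p (\<lambda>i. s ! i)"
  by (simp add: rect_diag_def rdiag_def)

lemma mat_diag_eq_rdiag: "mat_diag n f = rdiag n n f"
  by (auto simp: mat_diag_def rdiag_def)

lemma rdiag_cong: "(\<And>i. i < n \<Longrightarrow> i < p \<Longrightarrow> f i = g i) \<Longrightarrow> rdiag n p f = rdiag n p g"
  by (auto simp: rdiag_def)

lemma transpose_rdiag: "(rdiag n p f)\<^sup>T = rdiag p n f"
  by (auto simp: rdiag_def)

text \<open>The guard \<open>i < m\<close> matters when the inner dimension is the smallest: the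
  product then has zeros at later diagonal positions.\<close>

lemma rdiag_mult: "rdiag n m f * rdiag m p g = rdiag n p (\<lambda>i. if i < m then f i * g i else 0)"
proof (rule eq_matI)
  fix i j assume "i < dim_row (rdiag n p (\<lambda>i. if i < m then f i * g i else 0))"
    "j < dim_col (rdiag n p (\<lambda>i. if i < m then f i * g i else 0))"
  then have ij: "i < n" "j < p" by auto
  have "(rdiag n m f * rdiag m p g) $$ (i, j) =
      (\<Sum>l<m. (if i = l then f i else 0) * (if l = j then g l else 0))"
    using ij by (simp add: rdiag_def scalar_prod_def atLeast0LessThan)
  also have "\<dots> = (\<Sum>l<m. if l = i then (if i = j then f i * g i else 0) else 0)"
    by (intro sum.cong) auto
  finally show "(rdiag n m f * rdiag m p g) $$ (i, j) = rdiag n p (\<lambda>i. if i < m then f i * g i else 0) $$ (i, j)"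
    using ij by (simp add: rdiag_def)
qed simp_all

lemma rdiag_mem_stiefel: "k \<le> n \<Longrightarrow> rdiag n k (\<lambda>_. 1) \<in> stiefel n k"
  by (auto simp: stiefel_def transpose_rdiag rdiag_mult) (auto simp: rdiag_def intro!: eq_matI)

lemma stiefel_rank:
  assumes "Q \<in> stiefel n k"
  shows "vec_space.rank n Q = k"
proof -
  interpret vec_space "TYPE(real)" n .
  have Q: "Q \<in> carrier_mat n k" "Q\<^sup>T * Q = 1\<^sub>m k"
    using assms by (auto simp: stiefel_def)
  have on: "orthonormal_family n {..<k} (col Q)"
    using assms stiefel_iff_cols[OF Q(1)] by simp
  \<comment> \<open>Independence is stated for the set of columns, so repeated columns have to be
    excluded before the set can stand for the matrix.\<close>
  have "distinct (cols Q)"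
    unfolding distinct_conv_nth
  proof (intro allI impI)
    fix i j assume ij: "i < length (cols Q)" "j < length (cols Q)" "i \<noteq> j"
    then have "col Q i \<bullet> col Q j = 0" "col Q i \<bullet> col Q i = 1"
      using on Q(1) by (auto simp: orthonormal_family_def)
    then show "cols Q ! i \<noteq> cols Q ! j"
      using ij by auto
  qed
  moreover have "lin_indpt (set (cols Q))"
  proof
    assume "lin_dep (set (cols Q))"
    then obtain v where v: "v \<in> carrier_vec k" "v \<noteq> 0\<^sub>v k" "Q *\<^sub>v v = 0\<^sub>v n"
      using lin_depE[OF Q(1)] \<open>distinct (cols Q)\<close> by blast
    \<comment> \<open>The transpose is a left inverse of \<open>Q\<close>, so the kernel of
      \<open>Q\<close> is trivial.\<close>
    have "v = Q\<^sup>T * Q *\<^sub>v v"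
      using Q v(1) by simp
    also have "\<dots> = Q\<^sup>T *\<^sub>v (Q *\<^sub>v v)"
      using Q(1) v(1) by (intro assoc_mult_mat_vec) auto
    also have "\<dots> = 0\<^sub>v k"
      unfolding v(3) using Q(1) by (auto intro!: eq_vecI)
    finally show False using v(2) by simp
  qed
  ultimately show ?thesis
    using lin_indpt_full_rank[OF Q(1)] by simp
qed

text \<open>Matrices that are right multiples of each other have the same column space.\<close>

lemma rank_cong_col_space:
  fixes A B :: "real mat"
  assumes "A \<in> carrier_mat n k" "B \<in> carrier_mat n m" "C \<in> carrier_mat k m" "D \<in> carrier_mat m k"
    and "B = A * C" "A = B * D"
  shows "vec_space.rank n A = vec_space.rank n B"
proof -
  interpret vec_space "TYPE(real)" n .
  have sub: "col_space (A' * C') \<subseteq> col_space A'"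
    if c: "A' \<in> carrier_mat n k'" "C' \<in> carrier_mat k' m'" for A' C' :: "real mat" and k' m'
  proof
    fix y assume "y \<in> col_space (A' * C')"
    then obtain x where x: "x \<in> carrier_vec m'" "y = A' * C' *\<^sub>v x" and y: "y \<in> carrier_vec n"
      using c unfolding col_space_eq[OF mult_carrier_mat[OF c]] by auto
    have "y = A' *\<^sub>v (C' *\<^sub>v x)"
      using x assoc_mult_mat_vec[OF c x(1)] by simp
    moreover have "C' *\<^sub>v x \<in> carrier_vec k'"
      using c(2) x(1) by simp
    ultimately show "y \<in> col_space A'"
      using y c(1) unfolding col_space_eq[OF c(1)] by blast
  qed
  have "col_space A = col_space B"
    using sub[OF assms(1,3)] sub[OF assms(2,4)] by (simp flip: assms(5,6))
  then show ?thesis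
    by (simp add: rank_def col_space_def)
qed

text \<open>\<open>X\<close> and the matrix of the first \<open>k\<close> columns of
  \<open>U\<close> are right multiples of each other, and the latter has rank \<open>k\<close>. This
  identifies the rank with the number of nonzero singular values.\<close>

lemma rank_svd:
  assumes U: "U \<in> orthogonal_group n" and V: "V \<in> orthogonal_group p" and X: "X = U * rdiag n p s * V\<^sup>T"
    and "p \<le> n" "k \<le> p" and s: "\<And>i. i < p \<Longrightarrow> s i \<noteq> 0 \<longleftrightarrow> i < k"
  shows "vec_space.rank n X = k"
proof -
  have c: "U \<in> carrier_mat n n" "V \<in> carrier_mat p p" "V\<^sup>T * V = 1\<^sub>m p"
    using U V by (auto simp: orthogonal_group_def)
  define J where "J = rdiag n k (\<lambda>_. 1)"
  have UJ: "U * J \<in> stiefel n k"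
    using stiefel_mult[of U n n J k] rdiag_mem_stiefel[of k n] U assms(4,5)
    by (simp add: J_def orthogonal_group_eq_stiefel)
  have "rdiag n p s = J * rdiag k p s"
    unfolding J_def rdiag_mult using s by (intro rdiag_cong) auto
  then have 1: "X = (U * J) * (rdiag k p s * V\<^sup>T)"
    unfolding X using c by (simp add: J_def mult_mat_assoc)
  \<comment> \<open>Only the indices \<open>i < k\<close> occur on this diagonal, and there
    \<open>s i\<close> is invertible.\<close>
  have "J = rdiag n p s * rdiag p k (\<lambda>i. 1 / s i)"
    unfolding J_def rdiag_mult using s assms(5) by (intro rdiag_cong) auto
  moreover have "X * (V * rdiag p k (\<lambda>i. 1 / s i)) = U * (rdiag n p s * ((V\<^sup>T * V) * rdiag p k (\<lambda>i. 1 / s i)))"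
    unfolding X using c(1,2) by (simp add: mult_mat_assoc)
  ultimately have 2: "U * J = X * (V * rdiag p k (\<lambda>i. 1 / s i))"
    unfolding c(3) by simp
  have "vec_space.rank n (U * J) = vec_space.rank n X"
    by (rule rank_cong_col_space[OF _ _ _ _ 1 2]) (use c in \<open>auto simp: J_def X\<close>)
  then show ?thesis
    using stiefel_rank[OF UJ] by simp
qed

section \<open>Sign, order and support of the singular values\<close>

lemma singular_values_props:
  assumes X: "X \<in> carrier_mat n p"
  shows "length (singular_values X) = p"
    and "i < p \<Longrightarrow> 0 \<le> singular_values X ! i"
    and "i \<le> j \<Longrightarrow> j < p \<Longrightarrow> singular_values X ! j \<le> singular_values X ! i"
proof -
  obtain V s where V: "V \<in> orthogonal_group p" and s: "\<forall>i. 0 \<le> s i"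
    and gram: "X\<^sup>T * X = V * mat_diag p (\<lambda>i. s i * s i) * V\<^sup>T"
    using gram_spectral[OF X] by blast
  have m: "mset (singular_values X) = mset (map s [0..<p])"
    using mset_singular_values[OF V gram] s by simp
  show len: "length (singular_values X) = p"
    using mset_eq_length[OF m] by simp
  show "0 \<le> singular_values X ! i" if "i < p"
    using mset_eq_setD[OF m] nth_mem[of i "singular_values X"] that len s by auto
  have "sorted (rev (singular_values X))"
    by (simp add: singular_values_def)
  then show "singular_values X ! j \<le> singular_values X ! i" if "i \<le> j" "j < p"
    using that len by (simp add: sorted_rev_iff_nth_mono)
qed

lemma nonzero_initial_segment:
  fixes s :: "nat \<Rightarrow> real"
  assumes "\<And>i. i < p \<Longrightarrow> 0 \<le> s i" "\<And>i j. i \<le> j \<Longrightarrow> j < p \<Longrightarrow> s j \<le> s i"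
  shows "\<exists>k\<le>p. \<forall>i<p. s i \<noteq> 0 \<longleftrightarrow> i < k"
proof -
  \<comment> \<open>The alternative \<open>i = p\<close> keeps the minimum meaningful when no entry
    vanishes. Beyond \<open>k\<close> monotonicity and nonnegativity force zeros.\<close>
  define k where "k = (LEAST i. i = p \<or> s i = 0)"
  have k: "k = p \<or> s k = 0" and kp: "k \<le> p"
    unfolding k_def by (rule LeastI2[of _ p]; simp) (rule Least_le, simp)
  have "s i \<noteq> 0" if "i < k" for i
    using not_less_Least[of i "\<lambda>i. i = p \<or> s i = 0"] that by (simp add: k_def)
  moreover have "s i = 0" if "k \<le> i" "i < p" for i
    using k that assms(1)[of i] assms(2)[of k i] by auto
  ultimately show ?thesis
    using kp by (intro exI[of _ k]) (meson not_less)
qed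

lemma nuclear_norm_svd:
  assumes "X \<in> carrier_mat n p" "r \<le> p" "\<And>i. i < p \<Longrightarrow> singular_values X ! i \<noteq> 0 \<longleftrightarrow> i < r"
  shows "nuclear_norm X = (\<Sum>i<r. singular_values X ! i)"
proof -
  have zero: "singular_values X ! i = 0" if "r \<le> i" "i < p" for i
    using assms(3)[OF that(2)] that(1) by linarith
  have "nuclear_norm X = (\<Sum>i<p. singular_values X ! i)"
    using singular_values_props(1)[OF assms(1)]
    by (simp add: nuclear_norm_def sum_list_sum_nth atLeast0LessThan)
  also have "\<dots> = (\<Sum>i<r. singular_values X ! i)"
    using assms(2) zero by (intro sum.mono_neutral_right) auto
  finally show ?thesis .
qed

section \<open>Positive semidefinite perturbations\<close>

lemma psd_mats_add:
  assumes "A \<in> psd_mats n" "B \<in> psd_mats n"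
  shows "A + B \<in> psd_mats n"
proof -
  have c: "A \<in> carrier_mat n n" "B \<in> carrier_mat n n"
    using assms by (auto simp: psd_mats_def)
  have "0 \<le> x \<bullet> ((A + B) *\<^sub>v x)" if x: "x \<in> carrier_vec n" for x
  proof -
    have "x \<bullet> ((A + B) *\<^sub>v x) = x \<bullet> (A *\<^sub>v x) + x \<bullet> (B *\<^sub>v x)"
      using c x by (simp add: add_mult_distrib_mat_vec[OF c x] scalar_prod_add_distrib[of _ n])
    then show ?thesis
      using assms x by (simp add: psd_mats_def)
  qed
  moreover have "(A + B)\<^sup>T = A + B"
    using assms transpose_add[OF c] by (simp add: psd_mats_def)
  ultimately show ?thesis
    using c by (simp add: psd_mats_def)
qed

lemma smult_mat_mult_vec:
  fixes A :: "real mat"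
  assumes "A \<in> carrier_mat n m" "x \<in> carrier_vec m"
  shows "(t \<cdot>\<^sub>m A) *\<^sub>v x = t \<cdot>\<^sub>v (A *\<^sub>v x)"
  using assms by (auto intro!: eq_vecI simp: scalar_prod_def sum_distrib_left mult_ac)

lemma psd_mats_smult:
  assumes "A \<in> psd_mats n" "0 \<le> t"
  shows "t \<cdot>\<^sub>m A \<in> psd_mats n"
proof -
  have A: "A \<in> carrier_mat n n" "A\<^sup>T = A" "\<And>x. x \<in> carrier_vec n \<Longrightarrow> 0 \<le> x \<bullet> (A *\<^sub>v x)"
    using assms(1) by (auto simp: psd_mats_def)
  have "(t \<cdot>\<^sub>m A)\<^sup>T = t \<cdot>\<^sub>m A\<^sup>T"
    by (rule eq_matI) auto
  moreover have "0 \<le> x \<bullet> ((t \<cdot>\<^sub>m A) *\<^sub>v x)" if "x \<in> carrier_vec n" for x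
    using A(1) A(3)[OF that] assms(2) that
    by (simp add: smult_mat_mult_vec scalar_prod_smult_distrib[of _ n])
  ultimately show ?thesis
    using A by (simp add: psd_mats_def)
qed

lemma psd_mats_four_block:
  assumes "A \<in> psd_mats r"
  shows "four_block_mat A (0\<^sub>m r m) (0\<^sub>m m r) (0\<^sub>m m m) \<in> psd_mats (r + m)"
proof -
  have A: "A \<in> carrier_mat r r" "A\<^sup>T = A" "\<And>x. x \<in> carrier_vec r \<Longrightarrow> 0 \<le> x \<bullet> (A *\<^sub>v x)"
    using assms(1) by (auto simp: psd_mats_def)
  have "0 \<le> x \<bullet> (four_block_mat A (0\<^sub>m r m) (0\<^sub>m m r) (0\<^sub>m m m) *\<^sub>v x)" if x: "x \<in> carrier_vec (r + m)" for x
  proof -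
    define a d where "a = vec_first x r" and "d = vec_last x m"
    have ad: "a \<in> carrier_vec r" "d \<in> carrier_vec m" "x = a @\<^sub>v d"
      using x by (auto simp: a_def d_def)
    have "four_block_mat A (0\<^sub>m r m) (0\<^sub>m m r) (0\<^sub>m m m) *\<^sub>v x = (A *\<^sub>v a) @\<^sub>v 0\<^sub>v m"
      unfolding ad(3) using A(1) ad(1,2)
      by (subst four_block_mat_mult_vec[of _ r r _ m _ m]) (auto intro!: eq_vecI)
    then have "x \<bullet> (four_block_mat A (0\<^sub>m r m) (0\<^sub>m m r) (0\<^sub>m m m) *\<^sub>v x) = a \<bullet> (A *\<^sub>v a)"
      using A(1) ad by (simp add: scalar_prod_append[of _ r _ m])
    then show ?thesis
      using A(3)[OF ad(1)] by simp
  qed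
  then show ?thesis
    using A by (simp add: psd_mats_def transpose_four_block_diag)
qed

text \<open>A crude bound by the sum of the absolute entries, from
  \<open>\<bar>x $ i * x $ j\<bar> \<le> x \<bullet> x\<close>; any finite constant suffices for
  choosing a small step length.\<close>

lemma quadratic_form_bound:
  fixes T :: "real mat"
  assumes T: "T \<in> carrier_mat r r" and x: "x \<in> carrier_vec r"
  shows "x \<bullet> (T *\<^sub>v x) \<le> (\<Sum>i<r. \<Sum>j<r. \<bar>T $$ (i, j)\<bar>) * (x \<bullet> x)"
proof -
  have xx: "x \<bullet> x = (\<Sum>i<r. (x $ i)\<^sup>2)"
    using x by (simp add: scalar_prod_def atLeast0LessThan power2_eq_square)
  have sq: "(x $ i)\<^sup>2 \<le> x \<bullet> x" if "i < r" for i
    unfolding xx using that by (intro member_le_sum) auto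
  have bound: "x $ i * (T $$ (i, j) * x $ j) \<le> \<bar>T $$ (i, j)\<bar> * (x \<bullet> x)" if "i < r" "j < r" for i j
  proof -
    have "2 * \<bar>x $ i * x $ j\<bar> \<le> (x $ i)\<^sup>2 + (x $ j)\<^sup>2"
      using sum_squares_bound[of "\<bar>x $ i\<bar>" "\<bar>x $ j\<bar>"] by (simp add: abs_mult)
    then have "\<bar>x $ i * x $ j\<bar> \<le> x \<bullet> x"
      using sq[OF that(1)] sq[OF that(2)] by simp
    then have "\<bar>T $$ (i, j)\<bar> * \<bar>x $ i * x $ j\<bar> \<le> \<bar>T $$ (i, j)\<bar> * (x \<bullet> x)"
      by (rule mult_left_mono) simp
    moreover have "x $ i * (T $$ (i, j) * x $ j) \<le> \<bar>T $$ (i, j)\<bar> * \<bar>x $ i * x $ j\<bar>"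
      by (metis abs_ge_self abs_mult mult.left_commute)
    ultimately show ?thesis by linarith
  qed
  have "x \<bullet> (T *\<^sub>v x) = (\<Sum>i<r. \<Sum>j<r. x $ i * (T $$ (i, j) * x $ j))"
    using T x by (simp add: scalar_prod_def atLeast0LessThan sum_distrib_left)
  also have "\<dots> \<le> (\<Sum>i<r. \<Sum>j<r. \<bar>T $$ (i, j)\<bar> * (x \<bullet> x))"
    using bound by (intro sum_mono) auto
  finally show ?thesis
    by (simp add: sum_distrib_right)
qed

text \<open>The diagonal form dominates its least entry times \<open>x \<bullet> x\<close>, and the
  form of \<open>T\<close> is at most a constant times \<open>x \<bullet> x\<close>, so a small
  multiple of \<open>T\<close> can be subtracted.\<close>

lemma mat_diag_minus_smult_psd:
  fixes T :: "real mat"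
  assumes T: "T \<in> carrier_mat r r" "T\<^sup>T = T" and f: "\<And>i. i < r \<Longrightarrow> 0 < f i"
  shows "\<exists>t>0. mat_diag r f - t \<cdot>\<^sub>m T \<in> psd_mats r"
proof -
  define c where "c = (\<Sum>i<r. \<Sum>j<r. \<bar>T $$ (i, j)\<bar>)"
  have c: "0 \<le> c"
    unfolding c_def by (intro sum_nonneg) auto
  \<comment> \<open>Inserting 1 keeps the minimum defined and positive for
    \<open>r = 0\<close>.\<close>
  define m where "m = Min (insert 1 (f ` {..<r}))"
  have m: "0 < m" "\<And>i. i < r \<Longrightarrow> m \<le> f i"
    using f by (auto simp: m_def)
  \<comment> \<open>The summand 1 avoids division by zero when \<open>T\<close> is zero.\<close>
  define t where "t = m / (c + 1)"
  have t: "0 < t" "t * c \<le> m"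
    using m(1) c by (auto simp: t_def field_simps)
  have "0 \<le> x \<bullet> ((mat_diag r f - t \<cdot>\<^sub>m T) *\<^sub>v x)" if x: "x \<in> carrier_vec r" for x
  proof -
    have "t * (x \<bullet> (T *\<^sub>v x)) \<le> t * (c * (x \<bullet> x))"
      using quadratic_form_bound[OF T(1) x] t(1) by (simp add: c_def)
    also have "\<dots> \<le> m * (x \<bullet> x)"
      using mult_right_mono[OF t(2) scalar_prod_self_nonneg[of x]] by (simp add: mult.assoc)
    also have "\<dots> = (\<Sum>i<r. m * (x $ i)\<^sup>2)"
      using x by (simp add: scalar_prod_def atLeast0LessThan power2_eq_square sum_distrib_left)
    also have "\<dots> \<le> x \<bullet> (mat_diag r f *\<^sub>v x)"
      unfolding scalar_prod_mat_diag[OF x] using m(2) by (intro sum_mono mult_right_mono) auto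
    finally show ?thesis
      using x T(1)
      by (simp add: minus_mult_distrib_mat_vec[of _ r r] smult_mat_mult_vec scalar_prod_minus_distrib[of _ r]
          scalar_prod_smult_distrib[of _ r] mult_mat_vec_carrier[of _ r r])
  qed
  moreover have "(mat_diag r f - t \<cdot>\<^sub>m T)\<^sup>T = mat_diag r f - t \<cdot>\<^sub>m T"
  proof (rule eq_matI)
    fix i j assume "i < dim_row (mat_diag r f - t \<cdot>\<^sub>m T)" "j < dim_col (mat_diag r f - t \<cdot>\<^sub>m T)"
    then have ij: "i < r" "j < r" using T(1) by auto
    have "T $$ (j, i) = T $$ (i, j)"
      using arg_cong[OF T(2), of "\<lambda>M. M $$ (i, j)"] ij T(1) by simp
    then show "(mat_diag r f - t \<cdot>\<^sub>m T)\<^sup>T $$ (i, j) = (mat_diag r f - t \<cdot>\<^sub>m T) $$ (i, j)"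
      using ij T(1) by (auto simp: mat_diag_def)
  qed (use T(1) in auto)
  ultimately show ?thesis
    using t(1) T(1) by (intro exI[of _ t]) (simp add: psd_mats_def minus_carrier_mat)
qed

section \<open>Block structure\<close>

text \<open>This and \<open>id_block\<close> are the two block shapes of \<open>pd_face\<close> and
  \<open>W_set\<close>, in terms of the sizes \<open>m\<close> and \<open>q\<close> of the remaining
  block instead of differences.\<close>

abbreviation corner :: "nat \<Rightarrow> nat \<Rightarrow> nat \<Rightarrow> real mat \<Rightarrow> real mat" where
  "corner r m q A \<equiv> four_block_mat A (0\<^sub>m r q) (0\<^sub>m m r) (0\<^sub>m m q)"

abbreviation id_block :: "nat \<Rightarrow> nat \<Rightarrow> nat \<Rightarrow> real mat \<Rightarrow> real mat" where
  "id_block r m q R \<equiv> four_block_mat (1\<^sub>m r) (0\<^sub>m r q) (0\<^sub>m m r) R"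

lemma id_block_mult_transpose:
  assumes "R \<in> carrier_mat m q"
  shows "id_block r m q R * (id_block r m q R)\<^sup>T = id_block r m m (R * R\<^sup>T)"
  using assms by (simp add: transpose_four_block_diag mult_four_block_diag[of _ r r _ r _ m q _ m])

lemma corner_mult_id_block:
  assumes "A \<in> carrier_mat r r" "R \<in> carrier_mat m q"
  shows "corner r m m A * id_block r m q R = corner r m q A"
  using assms by (simp add: mult_four_block_diag[of _ r r _ r _ m m _ q])

lemma id_block_mem_stiefel:
  assumes "R \<in> stiefel m q"
  shows "id_block r m q R \<in> stiefel (r + m) (r + q)"
  using assms by (auto simp: stiefel_def transpose_four_block_diag mult_four_block_diag[of _ r r _ r _ q m _ q])

lemma mat_trace_corner: "A \<in> carrier_mat r r \<Longrightarrow> mat_trace (corner r m m A) = mat_trace A"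
  using carrier_matD[of A r r]
  by (auto simp: mat_trace_def split: if_splits intro!: sum.mono_neutral_cong_right)

lemma corner_mat_diag:
  assumes "\<And>i. i < r + q \<Longrightarrow> r \<le> i \<Longrightarrow> s i = 0"
  shows "corner r m q (mat_diag r s) = rdiag (r + m) (r + q) s"
  using assms by (auto simp: rdiag_def mat_diag_def intro!: eq_matI)

text \<open>Orthogonality to the first \<open>r\<close> unit vectors kills the upper entries of the
  remaining columns, so their lower parts are orthonormal themselves.\<close>

lemma stiefel_block_form:
  assumes Q: "Q \<in> stiefel (r + m) (r + q)" and unit: "\<And>i. i < r \<Longrightarrow> col Q i = unit_vec (r + m) i"
  shows "\<exists>R \<in> stiefel m q. Q = id_block r m q R"
proof -
  have Qc: "Q \<in> carrier_mat (r + m) (r + q)" "Q\<^sup>T * Q = 1\<^sub>m (r + q)"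
    using Q by (auto simp: stiefel_def)
  have ent: "Q $$ (i, j) = (if i = j then 1 else 0)" if "j < r" "i < r + m" for i j
  proof -
    have "Q $$ (i, j) = col Q j $ i"
      using that Qc(1) by simp
    then show ?thesis
      using that unit[OF that(1)] by simp
  qed
  have orth: "Q $$ (i, j) = 0" if "i < r" "r \<le> j" "j < r + q" for i j
  proof -
    have "Q $$ (i, j) = unit_vec (r + m) i \<bullet> col Q j"
      using that Qc(1) by simp
    also have "\<dots> = (Q\<^sup>T * Q) $$ (i, j)"
      using that Qc(1) unit[OF that(1)] by simp
    finally show ?thesis
      unfolding Qc(2) using that by simp
  qed
  define R where "R = mat m q (\<lambda>(i, j). Q $$ (r + i, r + j))"
  have R: "R \<in> carrier_mat m q"
    by (simp add: R_def)
  have Q_eq: "Q = id_block r m q R"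
    using Qc(1) R by (intro eq_matI) (auto simp: ent orth R_def)
  have "id_block r q q (R\<^sup>T * R) = 1\<^sub>m (r + q)"
    using Qc(2) R unfolding Q_eq by (simp add: transpose_four_block_diag mult_four_block_diag[of _ r r _ r _ q m _ q])
  then have block: "id_block r q q (R\<^sup>T * R) $$ (r + i, r + j) = 1\<^sub>m (r + q) $$ (r + i, r + j)" for i j
    by simp
  have "(R\<^sup>T * R) $$ (i, j) = 1\<^sub>m q $$ (i, j)" if "i < q" "j < q" for i j
    using block[of i j] that R by (simp del: index_mult_mat(1))
  then have "R\<^sup>T * R = 1\<^sub>m q"
    using R by (intro eq_matI) auto
  then show ?thesis
    using R Q_eq by (auto simp: stiefel_def)
qed

text \<open>The given decomposition is a thin one with left factor the first \<open>r + q\<close>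
  columns of \<open>U\<close>. The equality case of the duality therefore identifies the first
  \<open>r\<close> columns of \<open>G * V\<close> with those of \<open>U\<close>.\<close>

lemma nuclear_norm_dual_block_form:
  assumes U: "U \<in> orthogonal_group (r + m)" and V: "V \<in> orthogonal_group (r + q)" and "q \<le> m"
    and X: "X = U * rdiag (r + m) (r + q) s * V\<^sup>T"
    and s: "\<And>i. i < r + q \<Longrightarrow> 0 \<le> s i" "\<And>i. i < r \<Longrightarrow> s i \<noteq> 0"
    and G: "G \<in> stiefel (r + m) (r + q)" "mat_trace (G\<^sup>T * X) = nuclear_norm X"
  shows "\<exists>R \<in> stiefel m q. U\<^sup>T * G * V = id_block r m q R"
proof (rule stiefel_block_form)
  define n p where "n = r + m" and "p = r + q"
  have c: "U \<in> carrier_mat n n" "U\<^sup>T * U = 1\<^sub>m n" "V \<in> carrier_mat p p" "G \<in> carrier_mat n p"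
    using U V G(1) by (auto simp: orthogonal_group_def stiefel_def n_def p_def)
  have le: "p \<le> n"
    using \<open>q \<le> m\<close> by (simp add: n_def p_def)
  show "U\<^sup>T * G * V \<in> stiefel (r + m) (r + q)"
    using U V G(1) transpose_mem_orthogonal_group[OF U]
    unfolding orthogonal_group_eq_stiefel by (blast intro: stiefel_mult)
  define J where "J = rdiag n p (\<lambda>_. 1)"
  \<comment> \<open>The duality lemma asks for nonnegativity at every index, whereas
    \<open>s\<close> is controlled only below \<open>p\<close>.\<close>
  define s' where "s' = (\<lambda>i. if i < p then s i else 0)"
  have UJ: "U * J \<in> stiefel n p"
    using stiefel_mult[of U n n J p] rdiag_mem_stiefel[OF le] U
    by (simp add: J_def n_def orthogonal_group_eq_stiefel)
  have "rdiag n p s = J * mat_diag p s'"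
    unfolding J_def mat_diag_eq_rdiag rdiag_mult by (intro rdiag_cong) (simp add: s'_def)
  then have X': "X = (U * J) * mat_diag p s' * V\<^sup>T"
    using c unfolding X n_def[symmetric] p_def[symmetric] by (simp add: J_def mult_mat_assoc)
  have col: "col (G * V) i = col (U * J) i" if "i < r" for i
    using trace_thin_svd_le_nuclear_norm(2)[of "U * J" n p V X s' G i] UJ V X' s G that
    by (auto simp: s'_def n_def p_def)
  show "col (U\<^sup>T * G * V) i = unit_vec (r + m) i" if "i < r" for i
  proof -
    have i: "i < p" "i < n"
      using that by (auto simp: n_def p_def)
    have "col (U\<^sup>T * G * V) i = col (U\<^sup>T * (G * V)) i"
      using c by (simp add: mult_mat_assoc)
    also have "\<dots> = U\<^sup>T *\<^sub>v col (G * V) i"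
      using c i by (intro col_mult2) auto
    also have "\<dots> = U\<^sup>T *\<^sub>v col (U * J) i"
      by (simp only: col[OF that])
    also have "\<dots> = col (U\<^sup>T * (U * J)) i"
      using c i by (intro col_mult2[symmetric]) (auto simp: J_def)
    also have "U\<^sup>T * (U * J) = J"
      using c by (intro mult_mat_cancel_left[OF c(2)]) (auto simp: J_def)
    also have "col J i = unit_vec n i"
      using i by (intro eq_vecI) (auto simp: J_def rdiag_def)
    finally show ?thesis
      by (simp add: n_def)
  qed
qed

lemma psd_minus_pd_face_carrier: "M \<in> psd_minus_pd_face n r \<Longrightarrow> M \<in> carrier_mat n n"
  by (auto simp: psd_minus_pd_face_def pd_face_def psd_mats_def minus_carrier_mat)

text \<open>For small \<open>t\<close> the middle factor is positive semidefinite, and after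
  conjugation the whole product is a polar form. Its nuclear norm is the trace of that factor, which
  adding a multiple of the trace-free \<open>M\<close> leaves unchanged.\<close>

lemma nuclear_norm_along_W:
  assumes U: "U \<in> orthogonal_group (r + m)" and V: "V \<in> orthogonal_group (r + q)"
    and s: "\<And>i. i < r \<Longrightarrow> 0 < s i"
    and M: "M \<in> psd_minus_pd_face (r + m) r" "mat_trace M = 0" and R: "R \<in> stiefel m q"
    and MR: "M * id_block r m m (R * R\<^sup>T) = M"
  shows "\<exists>t>0. nuclear_norm (U * (corner r m m (mat_diag r s) + t \<cdot>\<^sub>m M) * id_block r m q R * V\<^sup>T) = (\<Sum>i<r. s i)"
proof -
  define n p where "n = r + m" and "p = r + q"
  obtain P S A where PS: "P \<in> psd_mats n" "M = P - S" "A \<in> pd_mats r" "S = corner r m m A"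
    using M(1) by (auto simp: psd_minus_pd_face_def pd_face_def n_def)
  have A: "A \<in> carrier_mat r r" "A\<^sup>T = A"
    using PS(3) by (auto simp: pd_mats_def)
  have Rc: "R \<in> carrier_mat m q"
    using R by (simp add: stiefel_def)
  have c: "U \<in> carrier_mat n n" "U\<^sup>T * U = 1\<^sub>m n" "V \<in> carrier_mat p p" "V\<^sup>T * V = 1\<^sub>m p" "P \<in> carrier_mat n n"
    "S \<in> carrier_mat n n" "M \<in> carrier_mat n n"
    using U V PS(1) A psd_minus_pd_face_carrier[OF M(1)]
    by (auto simp: orthogonal_group_def psd_mats_def n_def p_def PS(4))
  obtain t where t: "0 < t" "mat_diag r s - t \<cdot>\<^sub>m A \<in> psd_mats r"
    using mat_diag_minus_smult_psd[OF A, of s] s by blast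
  define S0 where "S0 = corner r m m (mat_diag r s)"
  define Q where "Q = id_block r m q R"
  define N where "N = S0 + t \<cdot>\<^sub>m M"
  have S0: "S0 \<in> carrier_mat n n" and Q: "Q \<in> carrier_mat n p" and N: "N \<in> carrier_mat n n"
    using Rc c by (auto simp: S0_def Q_def N_def n_def p_def)
  \<comment> \<open>With \<open>M = P - S\<close> and \<open>S\<close> supported in the corner, the
    negative part is collected in the upper block, where the choice of \<open>t\<close> controls
    it.\<close>
  have "N = corner r m m (mat_diag r s - t \<cdot>\<^sub>m A) + t \<cdot>\<^sub>m P"
    using A(1) c(5) by (intro eq_matI) (auto simp: N_def S0_def PS(2,4) n_def algebra_simps)
  then have N_psd: "N \<in> psd_mats n"
    using psd_mats_add[OF psd_mats_four_block[OF t(2), of m]] psd_mats_smult[OF PS(1)] t(1)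
    by (simp add: n_def)
  have QQ: "Q * Q\<^sup>T = id_block r m m (R * R\<^sup>T)"
    using id_block_mult_transpose[OF Rc] by (simp add: Q_def)
  have "S0 * (Q * Q\<^sup>T) = S0"
    unfolding S0_def QQ using corner_mult_id_block[of "mat_diag r s" r "R * R\<^sup>T" m m] Rc by simp
  then have NQQ: "N * (Q * Q\<^sup>T) = N"
    using S0 c(7) Q MR unfolding N_def
    by (simp add: add_mult_distrib_mat[of _ n n _ _ n] mult_smult_assoc_mat[of _ n n _ n] QQ[symmetric])
  have N_tr: "mat_trace N = (\<Sum>i<r. s i)"
  proof -
    have "mat_trace N = mat_trace S0"
      using mat_trace_add[of S0 n "t \<cdot>\<^sub>m M"] mat_trace_smult[OF c(7), of t] S0 c(7) M(2) by (simp add: N_def)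
    also have "\<dots> = (\<Sum>i<r. s i)"
      by (simp add: S0_def mat_trace_corner) (simp add: mat_trace_def mat_diag_def)
    finally show ?thesis .
  qed
  \<comment> \<open>Inserting \<open>U\<^sup>T * U\<close> turns
    \<open>U * N * Q * V\<^sup>T\<close> into a positive semidefinite matrix times a Stiefel
    matrix.\<close>
  define N' Q' where "N' = U * N * U\<^sup>T" and "Q' = U * Q * V\<^sup>T"
  have N': "N' \<in> psd_mats n"
    using psd_mats_congruence[OF N_psd, of "U\<^sup>T" n] c(1) by (simp add: N'_def)
  have Q': "Q' \<in> stiefel n p"
    using id_block_mem_stiefel[OF R, of r] U transpose_mem_orthogonal_group[OF V]
    unfolding Q'_def Q_def orthogonal_group_eq_stiefel n_def p_def by (blast intro: stiefel_mult)
  have "N' * (Q' * Q'\<^sup>T) = U * (N * ((U\<^sup>T * U) * (Q * ((V\<^sup>T * V) * (Q\<^sup>T * U\<^sup>T)))))"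
    using c(1,3) N Q by (simp add: N'_def Q'_def transpose_mult_dim mult_mat_assoc)
  also have "\<dots> = U * (N * (Q * Q\<^sup>T)) * U\<^sup>T"
    using c(1,3) N Q unfolding c(2,4) by (simp add: mult_mat_assoc)
  finally have "nuclear_norm (N' * Q') = mat_trace N'"
    unfolding NQQ using nuclear_norm_polar[OF N' Q'] by (simp add: N'_def)
  also have "mat_trace N' = mat_trace (U\<^sup>T * (U * N))"
    unfolding N'_def using c(1) N by (intro mat_trace_mult_commute) auto
  also have "U\<^sup>T * (U * N) = N"
    using c N by (intro mult_mat_cancel_left[OF c(2)]) auto
  also have "N' * Q' = U * (N * ((U\<^sup>T * U) * (Q * V\<^sup>T)))"
    using c(1,3) N Q by (simp add: N'_def Q'_def mult_mat_assoc)
  also have "\<dots> = U * N * Q * V\<^sup>T"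
    using c(1,3) N Q unfolding c(2) by (simp add: mult_mat_assoc)
  finally show ?thesis
    using t(1) N_tr by (auto simp: N_def S0_def Q_def)
qed

section \<open>Uniqueness of the solution and the kernel condition\<close>

lemma linear_on_mats_minus:
  assumes "linear_on_mats n p \<A>" "X \<in> carrier_mat n p" "Y \<in> carrier_mat n p"
  shows "\<A> (X - Y) = \<A> X - \<A> Y"
proof -
  have "X - Y = X + (- 1) \<cdot>\<^sub>m Y"
    using assms(2,3) by (intro eq_matI) auto
  also have "\<A> \<dots> = \<A> X + \<A> ((- 1) \<cdot>\<^sub>m Y)"
    using assms unfolding linear_on_mats_def by (metis smult_carrier_mat)
  also have "\<A> ((- 1) \<cdot>\<^sub>m Y) = (- 1) *\<^sub>R \<A> Y"
    using assms unfolding linear_on_mats_def by blast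
  finally show ?thesis by simp
qed

lemma mat_diag_mem_pd_mats:
  assumes "\<And>i. i < n \<Longrightarrow> 0 < d i"
  shows "mat_diag n d \<in> pd_mats n"
proof -
  have "0 < x \<bullet> (mat_diag n d *\<^sub>v x)" if x: "x \<in> carrier_vec n" "x \<noteq> 0\<^sub>v n" for x
  proof -
    obtain i where "i < n" "x $ i \<noteq> 0"
      using x by (metis carrier_vecD eq_vecI index_zero_vec)
    then show ?thesis
      unfolding scalar_prod_mat_diag[OF x(1)] using assms
      by (intro sum_pos2[of _ i]) (auto simp: less_imp_le)
  qed
  then show ?thesis
    by (simp add: pd_mats_def)
qed

theorem corollary4p1:
  fixes n p r :: nat
    and \<A> :: "real mat \<Rightarrow> 'e::real_inner"
    and b :: 'e
    and X U V :: "real mat"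
  assumes "0 < p" and "p \<le> n"
    and "\<exists>B :: 'e set. finite B \<and> span B = UNIV"
    and "linear_on_mats n p \<A>"
    and "X \<in> nuclear_norm_solutions n p \<A> b"
    and "r = vec_space.rank n X"
    and "U \<in> orthogonal_group n" and "V \<in> orthogonal_group p"
    and "X = U * rect_diag n p (singular_values X) * transpose_mat V"
  shows "nuclear_norm_solutions n p \<A> b = {X} \<longleftrightarrow>
         kernel_on_mats n p \<A> \<inter> W_set n p r U V = {0\<^sub>m n p}"
proof -
  define s where "s = (\<lambda>i. singular_values X ! i)"
  note lin = assms(4) and U = assms(7) and V = assms(8)
  have X: "X \<in> carrier_mat n p" and AX: "\<A> X = b"
    and min: "\<And>Y. Y \<in> carrier_mat n p \<Longrightarrow> \<A> Y = b \<Longrightarrow> nuclear_norm X \<le> nuclear_norm Y"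
    using assms(5) by (auto simp: nuclear_norm_solutions_def)
  have Xs: "X = U * rdiag n p s * V\<^sup>T"
    using assms(9) unfolding s_def rect_diag_eq_rdiag .
  \<comment> \<open>The nonzero singular values form an initial segment whose length is the rank, so
    exactly the first \<open>r\<close> are positive.\<close>
  obtain k where "k \<le> p" "\<forall>i<p. s i \<noteq> 0 \<longleftrightarrow> i < k"
    using nonzero_initial_segment[of p s] singular_values_props(2,3)[OF X] unfolding s_def by blast
  moreover from this have "r = k"
    using rank_svd[OF U V Xs assms(2)] assms(6) by blast
  ultimately have rp: "r \<le> p" and s_iff: "\<And>i. i < p \<Longrightarrow> s i \<noteq> 0 \<longleftrightarrow> i < r"
    by auto
  have s_nonneg: "0 \<le> s i" if "i < p" for i
    using singular_values_props(2)[OF X that] by (simp add: s_def)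
  have s_pos: "0 < s i" if "i < r" for i
    using s_iff[of i] s_nonneg[of i] that rp by simp
  have nX: "nuclear_norm X = (\<Sum>i<r. s i)"
    using nuclear_norm_svd[OF X rp] s_iff by (simp add: s_def)
  define m q where "m = n - r" and "q = p - r"
  have np: "n = r + m" "p = r + q" and qm: "q \<le> m"
    using rp assms(2) by (auto simp: m_def q_def)
  have c: "U \<in> carrier_mat n n" "U\<^sup>T * U = 1\<^sub>m n" "U * U\<^sup>T = 1\<^sub>m n"
    "V \<in> carrier_mat p p" "V\<^sup>T * V = 1\<^sub>m p" "V * V\<^sup>T = 1\<^sub>m p"
    using U V by (auto simp: orthogonal_group_def)
  define S0 where "S0 = corner r m m (mat_diag r s)"
  have S0: "S0 \<in> carrier_mat n n"
    by (simp add: S0_def np)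
  have s_zero: "s i = 0" if "i < p" "r \<le> i" for i
    using s_iff[OF that(1)] that(2) by linarith
  \<comment> \<open>\<open>S0\<close> has no lower block, so \<open>R\<close> is arbitrary:
    \<open>X\<close> can be written with the same \<open>R\<close> as any given element of
    \<open>W_set\<close>.\<close>
  have XS0: "X = U * S0 * id_block r m q R * V\<^sup>T" if "R \<in> carrier_mat m q" for R
  proof -
    have "S0 * id_block r m q R = rdiag n p s"
      unfolding S0_def using corner_mult_id_block[of "mat_diag r s" r R m q] that
        corner_mat_diag[of r q s m] s_zero by (simp add: np)
    then show ?thesis
      using c(1,4) S0 that unfolding Xs by (simp add: mult_mat_assoc np)
  qed
  have W_eq: "W_set n p r U V = {U * M * id_block r m q R * V\<^sup>T | M R.
      M \<in> psd_minus_pd_face n r \<and> mat_trace M = 0 \<and> R \<in> stiefel m q \<and> M * id_block r m m (R * R\<^sup>T) = M}"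
    by (simp add: W_set_def m_def q_def)
  \<comment> \<open>The witness is \<open>M = S - S\<close> with \<open>S\<close> the embedded
    identity block; some \<open>R\<close> exists because \<open>q \<le> m\<close>.\<close>
  have zero: "0\<^sub>m n p \<in> kernel_on_mats n p \<A> \<inter> W_set n p r U V"
  proof -
    have pd: "1\<^sub>m r \<in> pd_mats r"
      using scalar_prod_self_nonneg scalar_prod_self_eq_0_iff
      by (auto simp: pd_mats_def order.strict_iff_order)
    have "mat_diag r (\<lambda>_. 1) \<in> psd_mats r"
      by (rule mat_diag_mem_psd_mats) simp
    then have "corner r m m (1\<^sub>m r) \<in> psd_mats n"
      using psd_mats_four_block[of "1\<^sub>m r" r m] by (simp add: np)
    then have "corner r m m (1\<^sub>m r) - corner r m m (1\<^sub>m r) \<in> psd_minus_pd_face n r"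
      using pd unfolding psd_minus_pd_face_def pd_face_def m_def[symmetric] by blast
    moreover have "corner r m m (1\<^sub>m r) - corner r m m (1\<^sub>m r) = 0\<^sub>m n n"
      by (intro minus_r_inv_mat) (simp add: np)
    ultimately have "0\<^sub>m n n \<in> psd_minus_pd_face n r"
      by simp
    moreover obtain R where R: "R \<in> stiefel m q"
      using stiefel_nonempty[OF qm] by blast
    moreover have "mat_trace (0\<^sub>m n n) = 0"
      by (simp add: mat_trace_def)
    moreover have Rc: "R \<in> carrier_mat m q"
      using R by (simp add: stiefel_def)
    moreover have "id_block r m m (R * R\<^sup>T) \<in> carrier_mat n n" "id_block r m q R * V\<^sup>T \<in> carrier_mat n p"
      using Rc c(4) by (auto simp: np)
    moreover have "U * 0\<^sub>m n n * id_block r m q R * V\<^sup>T = 0\<^sub>m n p"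
      using c(1) \<open>id_block r m q R * V\<^sup>T \<in> carrier_mat n p\<close> Rc c(4)
      by (simp add: right_mult_zero_mat[OF c(1)] mult_mat_assoc np)
    ultimately have "0\<^sub>m n p \<in> W_set n p r U V"
      unfolding W_eq by (intro CollectI exI[of _ "0\<^sub>m n n"] exI[of _ R]) auto
    moreover have "\<A> (0\<^sub>m n p) = 0"
      using linear_on_mats_minus[OF lin X X] X by (simp add: minus_r_inv_mat)
    ultimately show ?thesis
      by (simp add: kernel_on_mats_def)
  qed
  show ?thesis
  proof
    assume uniq: "nuclear_norm_solutions n p \<A> b = {X}"
    have "H = 0\<^sub>m n p" if H: "H \<in> kernel_on_mats n p \<A> \<inter> W_set n p r U V" for H
    proof -
      obtain M R where HM: "H = U * M * id_block r m q R * V\<^sup>T" and M: "M \<in> psd_minus_pd_face n r" "mat_trace M = 0"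
        and R: "R \<in> stiefel m q" and MR: "M * id_block r m m (R * R\<^sup>T) = M"
        using H unfolding W_eq by blast
      have Hc: "H \<in> carrier_mat n p" and AH: "\<A> H = 0"
        using H by (auto simp: kernel_on_mats_def)
      \<comment> \<open>For this \<open>t\<close> the point \<open>X + t \<cdot>\<^sub>m H\<close>
        is feasible with the same nuclear norm, hence a solution, and uniqueness forces
        \<open>H\<close> to vanish.\<close>
      obtain t where t: "0 < t"
        "nuclear_norm (U * (S0 + t \<cdot>\<^sub>m M) * id_block r m q R * V\<^sup>T) = nuclear_norm X"
        using nuclear_norm_along_W[of U r m V q s M R] U V s_pos M R MR unfolding nX S0_def np by blast
      have Rc: "R \<in> carrier_mat m q" and Mc: "M \<in> carrier_mat n n"
        using R psd_minus_pd_face_carrier[OF M(1)] by (auto simp: stiefel_def)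
      define E where "E = id_block r m q R * V\<^sup>T"
      have E: "E \<in> carrier_mat n p"
        using Rc c(4) by (auto simp: E_def np)
      have "U * (S0 + t \<cdot>\<^sub>m M) * id_block r m q R * V\<^sup>T = U * ((S0 + t \<cdot>\<^sub>m M) * E)"
        using c(1,4) S0 Mc Rc by (simp add: mult_mat_assoc E_def np)
      also have "\<dots> = U * (S0 * E) + t \<cdot>\<^sub>m (U * (M * E))"
        using c(1) S0 Mc E
        by (simp add: add_mult_distrib_mat[of _ n n _ _ p] mult_add_distrib_mat[of _ n n _ p]
            mult_smult_assoc_mat[of _ n n _ p] mult_smult_distrib[of _ n n _ p])
      also have "U * (S0 * E) = X"
        using XS0[OF Rc] c(1,4) S0 Rc by (simp add: mult_mat_assoc E_def np)
      also have "U * (M * E) = H"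
        using HM c(1,4) Mc Rc by (simp add: mult_mat_assoc E_def np)
      finally have "nuclear_norm (X + t \<cdot>\<^sub>m H) = nuclear_norm X"
        using t(2) by simp
      moreover have XH: "X + t \<cdot>\<^sub>m H \<in> carrier_mat n p"
        using X Hc by simp
      moreover have "\<A> (X + t \<cdot>\<^sub>m H) = \<A> X + t *\<^sub>R \<A> H"
        using lin X Hc unfolding linear_on_mats_def by (metis smult_carrier_mat)
      ultimately have "X + t \<cdot>\<^sub>m H \<in> nuclear_norm_solutions n p \<A> b"
        using AX AH min by (simp add: nuclear_norm_solutions_def)
      then have eq: "X + t \<cdot>\<^sub>m H = X"
        using uniq by simp
      show ?thesis
      proof (rule eq_matI)
        fix i j assume "i < dim_row (0\<^sub>m n p)" "j < dim_col (0\<^sub>m n p)"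
        then show "H $$ (i, j) = 0\<^sub>m n p $$ (i, j)"
          using arg_cong[OF eq, of "\<lambda>M. M $$ (i, j)"] X Hc t(1) by simp
      qed (use Hc in auto)
    qed
    then show "kernel_on_mats n p \<A> \<inter> W_set n p r U V = {0\<^sub>m n p}"
      using zero by blast
  next
    assume triv: "kernel_on_mats n p \<A> \<inter> W_set n p r U V = {0\<^sub>m n p}"
    have "Y = X" if Y_sol: "Y \<in> nuclear_norm_solutions n p \<A> b" for Y
    proof -
      have Y: "Y \<in> carrier_mat n p" and AY: "\<A> Y = b"
        using Y_sol by (auto simp: nuclear_norm_solutions_def)
      have nY: "nuclear_norm Y = nuclear_norm X"
        using Y_sol min[OF Y AY] X AX by (auto simp: nuclear_norm_solutions_def intro!: antisym)
      \<comment> \<open>A dual matrix \<open>G\<close> for the feasible midpoint serves both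
        solutions at once.\<close>
      define Z where "Z = (1 / 2) \<cdot>\<^sub>m (X + Y)"
      have Z: "Z \<in> carrier_mat n p"
        using X Y by (simp add: Z_def)
      have "\<A> (X + Y) = b + b"
        using lin X Y AX AY unfolding linear_on_mats_def by simp
      then have "\<A> Z = (1 / 2) *\<^sub>R (b + b)"
        using lin X Y unfolding linear_on_mats_def Z_def by (metis add_carrier_mat)
      then have AZ: "\<A> Z = b"
        by (simp add: scaleR_2[symmetric])
      obtain G where G: "G \<in> stiefel n p" and GZ: "mat_trace (G\<^sup>T * Z) = nuclear_norm Z"
        using ex_trace_eq_nuclear_norm[OF Z assms(2)] by blast
      have Gc: "G \<in> carrier_mat n p" "G\<^sup>T * G = 1\<^sub>m p"
        using G by (auto simp: stiefel_def)
      have "G\<^sup>T * Z = (1 / 2) \<cdot>\<^sub>m (G\<^sup>T * X + G\<^sup>T * Y)"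
        using Gc(1) X Y by (simp add: Z_def mult_smult_distrib[of _ p n _ p] mult_add_distrib_mat[of _ p n _ p])
      then have "mat_trace (G\<^sup>T * Z) = (mat_trace (G\<^sup>T * X) + mat_trace (G\<^sup>T * Y)) / 2"
        using Gc(1) X Y mat_trace_smult[of "G\<^sup>T * X + G\<^sup>T * Y" p "1 / 2"] mat_trace_add[of "G\<^sup>T * X" p "G\<^sup>T * Y"]
        by simp
      \<comment> \<open>Both traces are at most \<open>nuclear_norm X\<close>, while by minimality
        their mean is at least that value; so both bounds are attained.\<close>
      then have GX: "mat_trace (G\<^sup>T * X) = nuclear_norm X" and GY: "mat_trace (G\<^sup>T * Y) = nuclear_norm Y"
        using GZ min[OF Z AZ] nY trace_le_nuclear_norm(1)[OF X assms(2) G] trace_le_nuclear_norm(1)[OF Y assms(2) G]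
        by auto
      obtain R where R: "R \<in> stiefel m q" and GR: "U\<^sup>T * G * V = id_block r m q R"
        using nuclear_norm_dual_block_form[of U r m V q X s G] U V qm Xs s_nonneg s_pos G GX
        unfolding np by fastforce
      have Rc: "R \<in> carrier_mat m q"
        using R by (simp add: stiefel_def)
      \<comment> \<open>The equality case for \<open>Y\<close> makes \<open>Y * G\<^sup>T\<close>
        positive semidefinite; \<open>P\<close> is this factor in the basis
        \<open>U\<close>.\<close>
      define P where "P = U\<^sup>T * (Y * G\<^sup>T) * U"
      have P: "P \<in> psd_mats n"
        using psd_mats_congruence[OF trace_le_nuclear_norm(2)[OF Y assms(2) G GY] c(1)] by (simp add: P_def)
      have Pc: "P \<in> carrier_mat n n"
        using P by (simp add: psd_mats_def)
      have P_tr: "mat_trace P = nuclear_norm X"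
      proof -
        have "mat_trace P = mat_trace (U * (U\<^sup>T * (Y * G\<^sup>T)))"
          unfolding P_def using c(1) Y Gc(1) by (intro mat_trace_mult_commute) auto
        also have "U * (U\<^sup>T * (Y * G\<^sup>T)) = Y * G\<^sup>T"
          using c(1) Y Gc(1) by (intro mult_mat_cancel_left[OF c(3)]) auto
        also have "mat_trace (Y * G\<^sup>T) = mat_trace (G\<^sup>T * Y)"
          using Y Gc(1) by (intro mat_trace_mult_commute) auto
        finally show ?thesis
          using GY nY by simp
      qed
      \<comment> \<open>Cancelling \<open>U * U\<^sup>T\<close> and \<open>G\<^sup>T * G\<close>
        shows that \<open>P\<close> and the block matrix of \<open>R\<close> reproduce
        \<open>Y\<close> in the bases \<open>U\<close> and \<open>V\<close>.\<close>
      have PE: "P * (U\<^sup>T * G * V) = U\<^sup>T * (Y * V)"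
      proof -
        have "P * (U\<^sup>T * G * V) = U\<^sup>T * (Y * (G\<^sup>T * ((U * U\<^sup>T) * (G * V))))"
          using c(1,4) Y Gc(1) by (simp add: P_def mult_mat_assoc)
        also have "\<dots> = U\<^sup>T * (Y * ((G\<^sup>T * G) * V))"
          using c(1,4) Y Gc(1) unfolding c(3) by (simp add: mult_mat_assoc)
        finally show ?thesis
          using c(4) Y unfolding Gc(2) by simp
      qed
      have S0_face: "S0 \<in> pd_face n r"
        using mat_diag_mem_pd_mats[of r s] psd_mats_four_block[OF mat_diag_mem_psd_mats, of r s m] s_pos
        unfolding pd_face_def m_def[symmetric] S0_def np(1)[symmetric] by (auto intro: less_imp_le)
      define M where "M = P - S0"
      have Mc: "M \<in> carrier_mat n n"
        using S0 by (simp add: M_def minus_carrier_mat)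
      have "M \<in> psd_minus_pd_face n r"
        using P S0_face by (auto simp: psd_minus_pd_face_def M_def)
      moreover have "mat_trace M = 0"
      proof -
        have "mat_trace S0 = (\<Sum>i<r. s i)"
          by (simp add: S0_def mat_trace_corner) (simp add: mat_trace_def mat_diag_def)
        then show ?thesis
          using mat_trace_minus[OF Pc S0] P_tr nX by (simp add: M_def)
      qed
      moreover have "M * id_block r m m (R * R\<^sup>T) = M"
      proof -
        \<comment> \<open>The block matrix is \<open>K * K\<^sup>T\<close> for
          \<open>K = U\<^sup>T * G * V\<close>. By \<open>PE\<close> the product
          \<open>P * K\<close> is \<open>U\<^sup>T * (Y * V)\<close>, and multiplying it by
          \<open>K\<^sup>T\<close> returns \<open>P\<close> because \<open>V * V\<^sup>T\<close>
          cancels.\<close>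
        have "P * id_block r m m (R * R\<^sup>T) = P * ((U\<^sup>T * G * V) * (U\<^sup>T * G * V)\<^sup>T)"
          using id_block_mult_transpose[OF Rc] GR by simp
        also have "\<dots> = (P * (U\<^sup>T * G * V)) * (U\<^sup>T * G * V)\<^sup>T"
          using c(1,4) Pc Gc(1) by (simp add: mult_mat_assoc)
        also have "\<dots> = U\<^sup>T * (Y * ((V * V\<^sup>T) * (G\<^sup>T * U)))"
          unfolding PE using c(1,4) Y Gc(1) by (simp add: mult_mat_assoc transpose_mult_dim)
        also have "\<dots> = P"
          using c(1,4) Y Gc(1) unfolding c(6) P_def by (simp add: mult_mat_assoc)
        finally have "P * id_block r m m (R * R\<^sup>T) = P" .
        moreover have "S0 * id_block r m m (R * R\<^sup>T) = S0"
          unfolding S0_def using corner_mult_id_block[of "mat_diag r s" r "R * R\<^sup>T" m m] Rc by simp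
        moreover have "id_block r m m (R * R\<^sup>T) \<in> carrier_mat n n"
          using Rc by (auto simp: np)
        ultimately show ?thesis
          unfolding M_def using Pc S0 by (simp add: minus_mult_distrib_mat[of _ n n _ _ n])
      qed
      moreover have "Y - X = U * M * id_block r m q R * V\<^sup>T"
      proof -
        define E where "E = id_block r m q R * V\<^sup>T"
        have E: "E \<in> carrier_mat n p"
          using Rc c(4) by (auto simp: E_def np)
        have "U * M * id_block r m q R * V\<^sup>T = U * (M * E)"
          using c(1,4) Mc Rc by (simp add: mult_mat_assoc E_def np)
        \<comment> \<open>The first term recovers \<open>Y\<close> by \<open>PE\<close>, the second
          recovers \<open>X\<close> by \<open>XS0\<close>, both with the same
          \<open>R\<close>.\<close>
        also have "\<dots> = U * (P * E) - U * (S0 * E)"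
          using c(1) Pc S0 E
          by (simp add: M_def minus_mult_distrib_mat[of _ n n _ _ p] mult_minus_distrib_mat[of _ n n _ p])
        also have "U * (S0 * E) = X"
          using XS0[OF Rc] c(1,4) S0 Rc by (simp add: mult_mat_assoc E_def np)
        also have "U * (P * E) = U * ((P * (U\<^sup>T * G * V)) * V\<^sup>T)"
          using c(1,4) Pc Rc by (simp add: mult_mat_assoc E_def GR np)
        also have "\<dots> = (U * U\<^sup>T) * (Y * (V * V\<^sup>T))"
          unfolding PE using c(1,4) Y by (simp add: mult_mat_assoc)
        also have "\<dots> = Y"
          using Y unfolding c(3,6) by simp
        finally show ?thesis ..
      qed
      ultimately have "Y - X \<in> W_set n p r U V"
        unfolding W_eq using R by blast
      moreover have "Y - X \<in> kernel_on_mats n p \<A>"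
        using linear_on_mats_minus[OF lin Y X] X AX AY by (simp add: kernel_on_mats_def minus_carrier_mat)
      ultimately have eq: "Y - X = 0\<^sub>m n p"
        using triv by blast
      show "Y = X"
      proof (rule eq_matI)
        fix i j assume "i < dim_row X" "j < dim_col X"
        then show "Y $$ (i, j) = X $$ (i, j)"
          using arg_cong[OF eq, of "\<lambda>M. M $$ (i, j)"] X Y by simp
      qed (use X Y in auto)
    qed
    then show "nuclear_norm_solutions n p \<A> b = {X}"
      using assms(5) by blast
  qed
qed

end
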